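(* Let $\mathcal{L}$ be a countable first-order language, let $T$ be an $\mathcal{L}$-theory and let $\mathcal{G}$ be an $\mathcal{L}$-hypersequent. If $T\models_{[0,1]}\mathcal{G}$, then for each positive integer $n$ there exist positive integers $m_1,\dots,m_k$ and formulas $C_1,\dots,C_k\in T$ (where $k\ge 0$; $k=0$ is allowed) such that $$\vdash_{\mathrm{G\text{Ł}}\forall}\; m_1C_1\Rightarrow_{\frac1n}\bot\mid\cdots\mid m_kC_k\Rightarrow_{\frac1n}\bot\mid\mathcal{G}_{\frac1n}.$$
   Context: **Syntax.** Fix two disjoint infinite sets of variables: free variables ($a,b,c,\dots$) and bound variables ($x,y,z,\dots$). A first-order language $\mathcal{L}$ consists of predicate, function and constant symbols (with arities). $\mathcal{L}$-terms are built from free variables, constants and function symbols; $\mathcal{L}$-semiterms may also use bound variables. $\mathcal{L}$-formulas: $\bot$; atomic formulas $P(t_1,\dots,t_k)$ with $t_i$ $\mathcal{L}$-terms; $A\to B$; and $\forall xA[x/a]$, $\exists xA[x/a]$, where $A$ is an $\mathcal{L}$-formula, $a$ a free variable, $x$ a bound variable not occurring in $A$, and $A[x/a]$ replaces every occurrence of $a$ by $x$. Semiformulas are like formulas except that bound variables may also occur free. For $\forall xA(x)$ or $\exists xA(x)$ and a term $t$, $A(t)$ is the result of replacing the free occurrences of $x$ in $A$ by $t$. A sequent $\Gamma\Rightarrow\Delta$ is an ordered pair of finite multisets of formulas. A hypersequent $\mathcal{S}_1\mid\cdots\mid\mathcal{S}_r$ is a finite multiset of sequents. An $\mathcal{L}$-theory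 is a set of $\mathcal{L}$-formulas. Commas and $\mid$ denote multiset union; $nA$ is the multiset of $n$ copies of $A$; $n\Gamma$ is the $n$-fold multiset union of $\Gamma$. **Affine $[0,1]$-semantics ($0$ is truth, $1$ is falsity).** A $[0,1]$-interpretation $\mathfrak{I}=(\mathcal{M},\beta)$ consists of a structure $\mathcal{M}$ with nonempty universe $M$, with the usual interpretations of constants and function symbols, and with $P^{\mathcal{M}}:M^k\to[0,1]$ for each $k$-ary predicate symbol $P$, together with an assignment $\beta$ of elements of $M$ to all free and bound variables, extended to semiterms as usual. $\mathfrak{I}[x\mapsto m]$ changes the value of $\beta$ at $x$ to $m$. Truth values: $[\![\bot]\!]=1$; $[\![P(t_1,\dots,t_k)]\!]=P^{\mathcal{M}}(\beta(t_1),\dots,\beta(t_k))$; $[\![A\to B]\!]=\max\{[\![B]\!]-[\![A]\!],0\}$; $[\![\forall xA]\!]_{\mathfrak{I}}=\sup_{m\in M}[\![A]\!]_{\mathfrak{I}[x\mapsto m]}$; $[\![\exists xA]\!]_{\mathfrak{I}}=\inf_{m\in M}[\![A]\!]_{\mathfrak{I}[x\mapsto m]}$; $[\![\Gamma]\!]=\sum_{A\in\Gamma}[\![A]\!]$ (with $[\![\varnothing]\!]=0$); $[\![\Gamma\Rightarrow\Delta]\!]=[\![\Delta]\!]-[\![\Gamma]\!]$; $[\![\mathcal{G}]\!]=\inf_{\mathcal{S}\in\mathcal{G}}[\![\mathcal{S}]\!]$. A hypersequent $\mathcal{G}$ is true in $\mathfrak{I}$ if $[\![\mathcal{G}]\!]_{\mathfrak{I}}\le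 0$. A formula $A$ is identified with the hypersequent $\Rightarrow A$, so $A$ is true iff $[\![A]\!]_{\mathfrak{I}}=0$. $\mathfrak{I}$ is a $[0,1]$-model of $T$ if every formula of $T$ is true in $\mathfrak{I}$. $T\models_{[0,1]}\mathcal{G}$ means that $\mathcal{G}$ is true in every $[0,1]$-model of $T$. **Calculus $\mathrm{GŁ}\forall$** (premises / conclusion; $\mathcal{G}$ is an arbitrary, possibly empty, side hypersequent unless stated otherwise). Axioms: $A\Rightarrow A$ (ID); $\Rightarrow$ (the empty sequent, EMP); $\bot\Rightarrow A$ ($\bot$). Structural rules: (EW) $\mathcal{G}$ / $\mathcal{G}\mid\Gamma\Rightarrow\Delta$, with $\mathcal{G}\ne\varnothing$; (EC) $\mathcal{G}\mid\Gamma\Rightarrow\Delta\mid\Gamma\Rightarrow\Delta$ / $\mathcal{G}\mid\Gamma\Rightarrow\Delta$; (IW) $\mathcal{G}\mid\Gamma\Rightarrow\Delta$ / $\mathcal{G}\mid\Gamma,A\Rightarrow\Delta$; (S) $\mathcal{G}\mid\Gamma_1,\Gamma_2\Rightarrow\Delta_1,\Delta_2$ / $\mathcal{G}\mid\Gamma_1\Rightarrow\Delta_1\mid\Gamma_2\Rightarrow\Delta_2$; (M) $\mathcal{G}\mid\Gamma_1\Rightarrow\Delta_1$ and $\mathcal{G}\mid\Gamma_2\Rightarrow\Delta_2$ / $\mathcal{G}\mid\Gamma_1,\Gamma_2\Rightarrow\Delta_1,\Delta_2$. Logical rules: ($\to\Rightarrow$) $\mathcal{G}\mid\Gamma\Rightarrow\Delta\mid\Gamma,B\Rightarrow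 A,\Delta$ / $\mathcal{G}\mid\Gamma,A\to B\Rightarrow\Delta$; ($\Rightarrow\to$) $\mathcal{G}\mid\Gamma\Rightarrow\Delta$ and $\mathcal{G}\mid\Gamma,A\Rightarrow B,\Delta$ / $\mathcal{G}\mid\Gamma\Rightarrow A\to B,\Delta$; ($\forall\Rightarrow$) $\mathcal{G}\mid\Gamma,A(t)\Rightarrow\Delta$ / $\mathcal{G}\mid\Gamma,\forall xA(x)\Rightarrow\Delta$; ($\Rightarrow\forall$) $\mathcal{G}\mid\Gamma\Rightarrow A(a),\Delta$ / $\mathcal{G}\mid\Gamma\Rightarrow\forall xA(x),\Delta$; ($\exists\Rightarrow$) $\mathcal{G}\mid\Gamma,A(a)\Rightarrow\Delta$ / $\mathcal{G}\mid\Gamma,\exists xA(x)\Rightarrow\Delta$; ($\Rightarrow\exists$) $\mathcal{G}\mid\Gamma\Rightarrow A(t),\Delta$ / $\mathcal{G}\mid\Gamma\Rightarrow\exists xA(x),\Delta$. Here $t$ is any $\mathcal{L}$-term, and the eigenvariable $a$ in ($\Rightarrow\forall$), ($\exists\Rightarrow$) is a free variable not occurring in the conclusion. $\vdash_{\mathrm{GŁ}\forall}\mathcal{G}$ means that $\mathcal{G}$ is the root of a finite derivation tree of $\mathcal{L}$-hypersequents whose leaves are axioms and whose other nodes are obtained by the rules. **Approximations.** For a positive integer $n$, $\Gamma\Rightarrow_{\frac1n}\Delta$ denotes the sequent $\bot,n\Gamma\Rightarrow n\Delta$. For $\mathcal{G}=\Gamma_1\Rightarrow\Delta_1\mid\cdots\mid\Gamma_r\Rightarrow\Delta_r$,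 $\mathcal{G}_{\frac1n}$ denotes $\Gamma_1\Rightarrow_{\frac1n}\Delta_1\mid\cdots\mid\Gamma_r\Rightarrow_{\frac1n}\Delta_r$. *)

theory Defs
  imports
    Complex_Main
    "HOL-Library.Multiset"
    "HOL-Library.Extended_Real"
    "HOL-Library.Countable_Set"
begin

section \<open>Syntax\<close>

text \<open>
  The symbols of a language are carrier sets, so a language may lack predicate or function symbols.
  Constant symbols are the function symbols of arity 0.
\<close>

record ('p, 'f) language =
  preds :: "'p set"
  pred_arity :: "'p \<Rightarrow> nat"
  funs :: "'f set"
  fun_arity :: "'f \<Rightarrow> nat"

definition countable_language :: "('p, 'f) language \<Rightarrow> bool" where
  "countable_language L \<longleftrightarrow> countable (preds L) \<and> countable (funs L)"

text \<open>Free variables \<open>Free a\<close> and bound variables \<open>Bnd x\<close> form two disjoint infinite sets.\<close>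

datatype var = Free nat | Bnd nat

datatype 'f tm = Var var | Fn 'f "'f tm list"

text \<open>
  The elements of the following type are raw expressions; the formulas of a language are singled
  out by \<open>formula\<close> below.
\<close>

datatype ('p, 'f) fm =
    Bot
  | Pred 'p "'f tm list"
  | Imp "('p, 'f) fm" "('p, 'f) fm"
  | All nat "('p, 'f) fm"
  | Ex nat "('p, 'f) fm"

primrec tm_vars :: "'f tm \<Rightarrow> var set" where
  "tm_vars (Var v) = {v}"
| "tm_vars (Fn f ts) = \<Union> (set (map tm_vars ts))"

text \<open>All variables with an occurrence of any kind, including those at a quantifier.\<close>

primrec fm_vars :: "('p, 'f) fm \<Rightarrow> var set" where
  "fm_vars Bot = {}"
| "fm_vars (Pred p ts) = \<Union> (tm_vars ` set ts)"
| "fm_vars (Imp A B) = fm_vars A \<union> fm_vars B"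
| "fm_vars (All x A) = insert (Bnd x) (fm_vars A)"
| "fm_vars (Ex x A) = insert (Bnd x) (fm_vars A)"

primrec tm_subst :: "var \<Rightarrow> 'f tm \<Rightarrow> 'f tm \<Rightarrow> 'f tm" where
  "tm_subst v s (Var w) = (if w = v then s else Var w)"
| "tm_subst v s (Fn f ts) = Fn f (map (tm_subst v s) ts)"

text \<open>
  \<open>subst v s A\<close> replaces the occurrences of \<open>v\<close> in \<open>A\<close> that are not bound by a quantifier. It is
  both $A[x/a]$, as \<open>subst (Free a) (Var (Bnd x)) A\<close>, and $A(t)$, as \<open>subst (Bnd x) t A\<close>. In both
  uses no variable is captured: $x$ does not occur in $A$, and $t$ has no bound variables.
\<close>

primrec subst :: "var \<Rightarrow> 'f tm \<Rightarrow> ('p, 'f) fm \<Rightarrow> ('p, 'f) fm" where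
  "subst v s Bot = Bot"
| "subst v s (Pred p ts) = Pred p (map (tm_subst v s) ts)"
| "subst v s (Imp A B) = Imp (subst v s A) (subst v s B)"
| "subst v s (All y A) = All y (if v = Bnd y then A else subst v s A)"
| "subst v s (Ex y A) = Ex y (if v = Bnd y then A else subst v s A)"

inductive lterm :: "('p, 'f) language \<Rightarrow> 'f tm \<Rightarrow> bool" for L where
  "lterm L (Var (Free a))"
| "f \<in> funs L \<Longrightarrow> length ts = fun_arity L f \<Longrightarrow> \<forall>t \<in> set ts. lterm L t \<Longrightarrow> lterm L (Fn f ts)"

inductive formula :: "('p, 'f) language \<Rightarrow> ('p, 'f) fm \<Rightarrow> bool" for L where
  "formula L Bot"
| "p \<in> preds L \<Longrightarrow> length ts = pred_arity L p \<Longrightarrow> \<forall>t \<in> set ts. lterm L t \<Longrightarrow> formula L (Pred p ts)"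
| "formula L A \<Longrightarrow> formula L B \<Longrightarrow> formula L (Imp A B)"
| "formula L A \<Longrightarrow> Bnd x \<notin> fm_vars A \<Longrightarrow> formula L (All x (subst (Free a) (Var (Bnd x)) A))"
| "formula L A \<Longrightarrow> Bnd x \<notin> fm_vars A \<Longrightarrow> formula L (Ex x (subst (Free a) (Var (Bnd x)) A))"

type_synonym ('p, 'f) sequent = "('p, 'f) fm multiset \<times> ('p, 'f) fm multiset"
type_synonym ('p, 'f) hypersequent = "('p, 'f) sequent multiset"

definition is_sequent :: "('p, 'f) language \<Rightarrow> ('p, 'f) sequent \<Rightarrow> bool" where
  "is_sequent L S \<longleftrightarrow> (\<forall>A \<in># fst S + snd S. formula L A)"

definition is_hypersequent :: "('p, 'f) language \<Rightarrow> ('p, 'f) hypersequent \<Rightarrow> bool" where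
  "is_hypersequent L G \<longleftrightarrow> (\<forall>S \<in># G. is_sequent L S)"

definition is_theory :: "('p, 'f) language \<Rightarrow> ('p, 'f) fm set \<Rightarrow> bool" where
  "is_theory L T \<longleftrightarrow> (\<forall>A \<in> T. formula L A)"

definition hypersequent_vars :: "('p, 'f) hypersequent \<Rightarrow> var set" where
  "hypersequent_vars G = (\<Union>S \<in> set_mset G. \<Union>A \<in> set_mset (fst S + snd S). fm_vars A)"


section \<open>Affine semantics on the unit interval (0 is truth, 1 is falsity)\<close>

record ('p, 'f, 'm) struct =
  univ :: "'m set"
  fun_interp :: "'f \<Rightarrow> 'm list \<Rightarrow> 'm"
  pred_interp :: "'p \<Rightarrow> 'm list \<Rightarrow> real"

definition is_interpretation ::
  "('p, 'f) language \<Rightarrow> ('p, 'f, 'm) struct \<Rightarrow> (var \<Rightarrow> 'm) \<Rightarrow> bool" where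
  "is_interpretation L M \<beta> \<longleftrightarrow>
     univ M \<noteq> {} \<and>
     (\<forall>f \<in> funs L. \<forall>ms. length ms = fun_arity L f \<and> set ms \<subseteq> univ M \<longrightarrow> fun_interp M f ms \<in> univ M) \<and>
     (\<forall>p \<in> preds L. \<forall>ms. length ms = pred_arity L p \<and> set ms \<subseteq> univ M \<longrightarrow> pred_interp M p ms \<in> {0..1}) \<and>
     (\<forall>v. \<beta> v \<in> univ M)"

primrec tm_val :: "('p, 'f, 'm) struct \<Rightarrow> (var \<Rightarrow> 'm) \<Rightarrow> 'f tm \<Rightarrow> 'm" where
  "tm_val M \<beta> (Var v) = \<beta> v"
| "tm_val M \<beta> (Fn f ts) = fun_interp M f (map (tm_val M \<beta>) ts)"

primrec fm_val :: "('p, 'f, 'm) struct \<Rightarrow> (var \<Rightarrow> 'm) \<Rightarrow> ('p, 'f) fm \<Rightarrow> real" where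
  "fm_val M \<beta> Bot = 1"
| "fm_val M \<beta> (Pred p ts) = pred_interp M p (map (tm_val M \<beta>) ts)"
| "fm_val M \<beta> (Imp A B) = max (fm_val M \<beta> B - fm_val M \<beta> A) 0"
| "fm_val M \<beta> (All x A) = (SUP m \<in> univ M. fm_val M (\<beta>(Bnd x := m)) A)"
| "fm_val M \<beta> (Ex x A) = (INF m \<in> univ M. fm_val M (\<beta>(Bnd x := m)) A)"

definition multiset_val :: "('p, 'f, 'm) struct \<Rightarrow> (var \<Rightarrow> 'm) \<Rightarrow> ('p, 'f) fm multiset \<Rightarrow> real" where
  "multiset_val M \<beta> \<Gamma> = (\<Sum>A \<in># \<Gamma>. fm_val M \<beta> A)"

definition sequent_val :: "('p, 'f, 'm) struct \<Rightarrow> (var \<Rightarrow> 'm) \<Rightarrow> ('p, 'f) sequent \<Rightarrow> real" where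
  "sequent_val M \<beta> S = multiset_val M \<beta> (snd S) - multiset_val M \<beta> (fst S)"

text \<open>The infimum is taken in \<open>ereal\<close> so that the empty hypersequent has value \<open>\<infinity>\<close> and is never true.\<close>

definition hypersequent_val ::
  "('p, 'f, 'm) struct \<Rightarrow> (var \<Rightarrow> 'm) \<Rightarrow> ('p, 'f) hypersequent \<Rightarrow> ereal" where
  "hypersequent_val M \<beta> G = (INF S \<in> set_mset G. ereal (sequent_val M \<beta> S))"

definition true_in ::
  "('p, 'f, 'm) struct \<Rightarrow> (var \<Rightarrow> 'm) \<Rightarrow> ('p, 'f) hypersequent \<Rightarrow> bool" where
  "true_in M \<beta> G \<longleftrightarrow> hypersequent_val M \<beta> G \<le> 0"

definition hypersequent_of :: "('p, 'f) fm \<Rightarrow> ('p, 'f) hypersequent" where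
  "hypersequent_of A = {#({#}, {#A#})#}"

definition is_model ::
  "('p, 'f) language \<Rightarrow> ('p, 'f, 'm) struct \<Rightarrow> (var \<Rightarrow> 'm) \<Rightarrow> ('p, 'f) fm set \<Rightarrow> bool" where
  "is_model L M \<beta> T \<longleftrightarrow> is_interpretation L M \<beta> \<and> (\<forall>A \<in> T. true_in M \<beta> (hypersequent_of A))"

text \<open>
  HOL cannot quantify over all types inside a formula, so entailment refers to the models whose
  universe is a nonempty subset, of any size, of a type \<open>'m\<close>. Over an infinite \<open>'m\<close> this includes,
  up to isomorphism, all countable models.
\<close>

definition entails ::
  "'m itself \<Rightarrow> ('p, 'f) language \<Rightarrow> ('p, 'f) fm set \<Rightarrow> ('p, 'f) hypersequent \<Rightarrow> bool" where
  "entails (_ :: 'm itself) L T G \<longleftrightarrow>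
     (\<forall>(M :: ('p, 'f, 'm) struct) \<beta>. is_model L M \<beta> T \<longrightarrow> true_in M \<beta> G)"


section \<open>The hypersequent calculus\<close>

text \<open>\<open>GL_rule L Ps H\<close>: the list \<open>Ps\<close> of premises and the conclusion \<open>H\<close> form an instance of an axiom or a rule.\<close>

inductive GL_rule ::
  "('p, 'f) language \<Rightarrow> ('p, 'f) hypersequent list \<Rightarrow> ('p, 'f) hypersequent \<Rightarrow> bool" for L where
  ID: "GL_rule L [] {#({#A#}, {#A#})#}"
| EMP: "GL_rule L [] {#({#}, {#})#}"
| BOT: "GL_rule L [] {#({#Bot#}, {#A#})#}"
| EW: "G \<noteq> {#} \<Longrightarrow> GL_rule L [G] (G + {#(\<Gamma>, \<Delta>)#})"
| EC: "GL_rule L [G + {#(\<Gamma>, \<Delta>), (\<Gamma>, \<Delta>)#}] (G + {#(\<Gamma>, \<Delta>)#})"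
| IW: "GL_rule L [G + {#(\<Gamma>, \<Delta>)#}] (G + {#(\<Gamma> + {#A#}, \<Delta>)#})"
| S: "GL_rule L [G + {#(\<Gamma>1 + \<Gamma>2, \<Delta>1 + \<Delta>2)#}] (G + {#(\<Gamma>1, \<Delta>1), (\<Gamma>2, \<Delta>2)#})"
| M: "GL_rule L [G + {#(\<Gamma>1, \<Delta>1)#}, G + {#(\<Gamma>2, \<Delta>2)#}] (G + {#(\<Gamma>1 + \<Gamma>2, \<Delta>1 + \<Delta>2)#})"
| Imp_left:
    "GL_rule L [G + {#(\<Gamma>, \<Delta>), (\<Gamma> + {#B#}, {#A#} + \<Delta>)#}] (G + {#(\<Gamma> + {#Imp A B#}, \<Delta>)#})"
| Imp_right:
    "GL_rule L [G + {#(\<Gamma>, \<Delta>)#}, G + {#(\<Gamma> + {#A#}, {#B#} + \<Delta>)#}] (G + {#(\<Gamma>, {#Imp A B#} + \<Delta>)#})"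
| All_left:
    "lterm L t \<Longrightarrow>
     GL_rule L [G + {#(\<Gamma> + {#subst (Bnd x) t A#}, \<Delta>)#}] (G + {#(\<Gamma> + {#All x A#}, \<Delta>)#})"
| All_right:
    "Free a \<notin> hypersequent_vars (G + {#(\<Gamma>, {#All x A#} + \<Delta>)#}) \<Longrightarrow>
     GL_rule L [G + {#(\<Gamma>, {#subst (Bnd x) (Var (Free a)) A#} + \<Delta>)#}] (G + {#(\<Gamma>, {#All x A#} + \<Delta>)#})"
| Ex_left:
    "Free a \<notin> hypersequent_vars (G + {#(\<Gamma> + {#Ex x A#}, \<Delta>)#}) \<Longrightarrow>
     GL_rule L [G + {#(\<Gamma> + {#subst (Bnd x) (Var (Free a)) A#}, \<Delta>)#}] (G + {#(\<Gamma> + {#Ex x A#}, \<Delta>)#})"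
| Ex_right:
    "lterm L t \<Longrightarrow>
     GL_rule L [G + {#(\<Gamma>, {#subst (Bnd x) t A#} + \<Delta>)#}] (G + {#(\<Gamma>, {#Ex x A#} + \<Delta>)#})"

text \<open>Every node of a derivation tree is a hypersequent of the language \<open>L\<close>.\<close>

inductive GL_derivable :: "('p, 'f) language \<Rightarrow> ('p, 'f) hypersequent \<Rightarrow> bool" for L where
  "GL_rule L Ps H \<Longrightarrow> is_hypersequent L H \<Longrightarrow> \<forall>P \<in> set Ps. GL_derivable L P \<Longrightarrow> GL_derivable L H"


section \<open>Approximations\<close>

definition approx_sequent :: "nat \<Rightarrow> ('p, 'f) sequent \<Rightarrow> ('p, 'f) sequent" where
  "approx_sequent n S = ({#Bot#} + repeat_mset n (fst S), repeat_mset n (snd S))"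

definition approx_hypersequent :: "nat \<Rightarrow> ('p, 'f) hypersequent \<Rightarrow> ('p, 'f) hypersequent" where
  "approx_hypersequent n G = image_mset (approx_sequent n) G"

end

theory Submission
  imports Defs "HOL-Analysis.Function_Topology"
begin

text \<open>
  The theorem is proved by contraposition. Let \<open>Y\<close> be the set of all sequents
  $mC \Rightarrow_{1/n} \bot$ with \<open>C \<in> T\<close> and \<open>m > 0\<close>, together with the sequents of the
  approximation of \<open>G\<close>, and suppose that no hypersequent over \<open>Y\<close> is derivable. This is the negation
  of the claim, because a derivable hypersequent over \<open>Y\<close> can be brought into the required form by
  external weakening and contraction. A model is constructed in which every sequent of \<open>Y\<close> has a
  value \<open>\<ge> 0\<close> (\<open>underivable_model\<close>). In it a formula \<open>C \<in> T\<close> of value \<open>c\<close> satisfies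
  \<open>n * (1 - m * c) - 1 \<ge> 0\<close> for all \<open>m > 0\<close>, hence \<open>c = 0\<close>, and each sequent of \<open>G\<close> has a value
  \<open>\<ge> 1 / n\<close>. So it is a model of \<open>T\<close> in which \<open>G\<close> is not true.

  The construction is a Henkin argument in which linear programming takes the place of Boolean
  consistency. Call a set of sequents consistent if no hypersequent over it is derivable. First, \<open>Y\<close> is
  extended to a consistent set \<open>X\<close> that is closed under reading the logical
  rules upwards (\<open>saturated_extension\<close>). Eigenvariables are available at each stage because
  the variables of \<open>Y\<close> are beforehand renamed to even numbers (\<open>consistent_doubled\<close>).

  Second, numbers in the unit interval are assigned to formulas, regarded as atoms, such that all sequents of
  \<open>X\<close> have nonnegative weight (\<open>consistent_valuation\<close>). For a finite set of sequents this is Gordan's theorem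
  (\<open>gordan\<close>): otherwise some sum of these sequents, with multiplicities, has a weight \<open>\<le> 0\<close> under each
  valuation. Such a sum follows from axioms by mixing (\<open>GL_derivable_if_weight_nonpos\<close>), and the splitting
  rule turns this into a derivation of a hypersequent over the set. For the whole of \<open>X\<close> it follows by
  compactness of the space of valuations.

  Third, the values of the atomic formulas define a structure on the set of terms. As \<open>X\<close> is
  saturated, the sequents of \<open>X\<close> have nonnegative values in it by induction on their
  complexity (\<open>saturated_weight_nonneg\<close>).
\<close>

section \<open>Simultaneous substitution for free variables\<close>

primrec tm_msubst :: "(nat \<Rightarrow> 'f tm) \<Rightarrow> 'f tm \<Rightarrow> 'f tm" where
  "tm_msubst \<sigma> (Var v) = (case v of Free a \<Rightarrow> \<sigma> a | Bnd x \<Rightarrow> Var (Bnd x))"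
| "tm_msubst \<sigma> (Fn f ts) = Fn f (map (tm_msubst \<sigma>) ts)"

primrec fm_msubst :: "(nat \<Rightarrow> 'f tm) \<Rightarrow> ('p, 'f) fm \<Rightarrow> ('p, 'f) fm" where
  "fm_msubst \<sigma> Bot = Bot"
| "fm_msubst \<sigma> (Pred p ts) = Pred p (map (tm_msubst \<sigma>) ts)"
| "fm_msubst \<sigma> (Imp A B) = Imp (fm_msubst \<sigma> A) (fm_msubst \<sigma> B)"
| "fm_msubst \<sigma> (All x A) = All x (fm_msubst \<sigma> A)"
| "fm_msubst \<sigma> (Ex x A) = Ex x (fm_msubst \<sigma> A)"

abbreviation idvar :: "nat \<Rightarrow> 'f tm" where
  "idvar \<equiv> \<lambda>a. Var (Free a)"

lemma lterm_no_Bnd: "lterm L t \<Longrightarrow> Bnd x \<notin> tm_vars t"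
  by (induction rule: lterm.induct) auto

lemma finite_tm_vars [simp]: "finite (tm_vars t)"
  by (induction t) auto

lemma finite_fm_vars [simp]: "finite (fm_vars A)"
  by (induction A) auto

lemma tm_subst_fresh: "v \<notin> tm_vars t \<Longrightarrow> tm_subst v s t = t"
  by (induction t) (auto intro: map_idI)

lemma tm_msubst_cong:
  "(\<And>a. Free a \<in> tm_vars t \<Longrightarrow> \<sigma> a = \<tau> a) \<Longrightarrow> tm_msubst \<sigma> t = tm_msubst \<tau> t"
proof (induction t)
  case (Var v) then show ?case by (cases v) auto
next
  case (Fn f ts) then show ?case by fastforce
qed

lemma fm_msubst_cong:
  "(\<And>a. Free a \<in> fm_vars A \<Longrightarrow> \<sigma> a = \<tau> a) \<Longrightarrow> fm_msubst \<sigma> A = fm_msubst \<tau> A"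
proof (induction A)
  case (Pred p ts)
  then show ?case by (auto intro!: tm_msubst_cong)
qed auto

lemma tm_msubst_idvar [simp]: "tm_msubst idvar t = t"
  by (induction t) (auto intro: map_idI split: var.split)

lemma fm_msubst_idvar [simp]: "fm_msubst idvar A = A"
  by (induction A) (auto intro: map_idI)

lemma tm_msubst_msubst: "tm_msubst \<tau> (tm_msubst \<sigma> t) = tm_msubst (\<lambda>a. tm_msubst \<tau> (\<sigma> a)) t"
  by (induction t) (auto split: var.split)

lemma fm_msubst_msubst: "fm_msubst \<tau> (fm_msubst \<sigma> A) = fm_msubst (\<lambda>a. tm_msubst \<tau> (\<sigma> a)) A"
  by (induction A) (auto simp: tm_msubst_msubst)

lemma tm_vars_msubst:
  "v \<in> tm_vars (tm_msubst \<sigma> t) \<Longrightarrow>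
   (\<exists>x. v = Bnd x \<and> v \<in> tm_vars t) \<or> (\<exists>a. Free a \<in> tm_vars t \<and> v \<in> tm_vars (\<sigma> a))"
proof (induction t)
  case (Var w) then show ?case by (cases w) auto
next
  case (Fn f ts)
  then obtain t where "t \<in> set ts" "v \<in> tm_vars (tm_msubst \<sigma> t)" by auto
  with Fn.IH[of t] show ?case by auto
qed

lemma fm_vars_msubst:
  "v \<in> fm_vars (fm_msubst \<sigma> A) \<Longrightarrow>
   (\<exists>x. v = Bnd x \<and> v \<in> fm_vars A) \<or> (\<exists>a. Free a \<in> fm_vars A \<and> v \<in> tm_vars (\<sigma> a))"
proof (induction A)
  case (Pred p ts)
  then obtain t where "t \<in> set ts" "v \<in> tm_vars (tm_msubst \<sigma> t)" by auto
  with tm_vars_msubst[of v \<sigma> t] show ?case by auto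
qed auto

lemma tm_msubst_subst:
  assumes "\<And>a. Bnd x \<notin> tm_vars (\<sigma> a)"
  shows "tm_msubst \<sigma> (tm_subst (Bnd x) s t) = tm_subst (Bnd x) (tm_msubst \<sigma> s) (tm_msubst \<sigma> t)"
  using assms by (induction t) (auto simp: tm_subst_fresh split: var.split)

lemma fm_msubst_subst:
  assumes "\<And>a. Bnd x \<notin> tm_vars (\<sigma> a)"
  shows "fm_msubst \<sigma> (subst (Bnd x) s A) = subst (Bnd x) (tm_msubst \<sigma> s) (fm_msubst \<sigma> A)"
  using assms by (induction A) (auto simp: tm_msubst_subst)

text \<open>Instantiating a quantifier amounts to substituting for the free variable that it closed off.\<close>

lemma tm_subst_subst_eq_msubst:
  "Bnd x \<notin> tm_vars t \<Longrightarrow>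
   tm_subst (Bnd x) s (tm_subst (Free a) (Var (Bnd x)) t) = tm_msubst (idvar(a := s)) t"
  by (induction t) (auto split: var.split)

lemma subst_subst_eq_msubst:
  "Bnd x \<notin> fm_vars A \<Longrightarrow>
   subst (Bnd x) s (subst (Free a) (Var (Bnd x)) A) = fm_msubst (idvar(a := s)) A"
  by (induction A) (auto simp: tm_subst_subst_eq_msubst)

text \<open>
  The variable \<open>a\<close> closed off by a quantifier is a dummy: exchanging it for a variable \<open>c\<close> that the
  substitution does not introduce lets the substitution pass under the quantifier.
\<close>

lemma tm_msubst_close:
  assumes "\<And>b. Free b \<in> tm_vars t \<Longrightarrow> Free c \<notin> tm_vars (\<sigma> b)"
  shows "tm_msubst \<sigma> (tm_subst (Free a) (Var (Bnd x)) t) =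
         tm_subst (Free c) (Var (Bnd x)) (tm_msubst (\<sigma>(a := Var (Free c))) t)"
  using assms by (induction t) (auto simp: tm_subst_fresh split: var.split)

lemma fm_msubst_close:
  assumes "\<And>b. Free b \<in> fm_vars A \<Longrightarrow> Free c \<notin> tm_vars (\<sigma> b)"
  shows "fm_msubst \<sigma> (subst (Free a) (Var (Bnd x)) A) =
         subst (Free c) (Var (Bnd x)) (fm_msubst (\<sigma>(a := Var (Free c))) A)"
  using assms
proof (induction A)
  case (Pred p ts)
  then show ?case by (simp del: fun_upd_apply) (blast intro: tm_msubst_close)
qed auto

lemma lterm_msubst: "lterm L t \<Longrightarrow> (\<And>a. lterm L (\<sigma> a)) \<Longrightarrow> lterm L (tm_msubst \<sigma> t)"
  by (induction rule: lterm.induct) (auto intro!: lterm.intros)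

lemma exists_var_avoiding_msubst:
  obtains c where "\<And>b. Free b \<in> fm_vars A \<Longrightarrow> Free c \<notin> tm_vars (\<sigma> b)"
proof -
  have "finite (Free -` fm_vars A)"
    by (rule finite_vimageI) (simp_all add: inj_on_def)
  then have "finite (\<Union>b \<in> Free -` fm_vars A. tm_vars (\<sigma> b))"
    by (intro finite_UN_I finite_tm_vars)
  moreover have "infinite (range Free)"
    by (rule range_inj_infinite) (simp add: inj_on_def)
  ultimately obtain c where "Free c \<notin> (\<Union>b \<in> Free -` fm_vars A. tm_vars (\<sigma> b))"
    by (meson finite_subset image_subsetI)
  then show ?thesis using that by blast
qed

text \<open>
  The induction has to be over all substitutions at once: in the quantifier cases the hypothesis is
  applied to a substitution modified at the variable that was closed off.
\<close>

lemma formula_msubst: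
  assumes "formula L A" and "\<And>a. lterm L (\<sigma> a)"
  shows "formula L (fm_msubst \<sigma> A)"
  using assms
proof (induction arbitrary: \<sigma> rule: formula.induct)
  case (2 p ts)
  then show ?case by (auto intro!: formula.intros lterm_msubst)
next
  case (4 A x a)
  obtain c where c: "\<And>b. Free b \<in> fm_vars A \<Longrightarrow> Free c \<notin> tm_vars (\<sigma> b)"
    using exists_var_avoiding_msubst[where A = A and \<sigma> = \<sigma>] by blast
  have "lterm L ((\<sigma>(a := Var (Free c))) b)" for b
    using 4 by (auto intro: lterm.intros)
  then have "formula L (fm_msubst (\<sigma>(a := Var (Free c))) A)"
    and "Bnd x \<notin> fm_vars (fm_msubst (\<sigma>(a := Var (Free c))) A)"
    using 4 fm_vars_msubst[of "Bnd x" "\<sigma>(a := Var (Free c))" A] lterm_no_Bnd[of L _ x] by blast+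
  then show ?case
    using c by (subst fm_msubst.simps, subst fm_msubst_close[of _ c]) (auto intro: formula.intros)
next
  case (5 A x a)
  obtain c where c: "\<And>b. Free b \<in> fm_vars A \<Longrightarrow> Free c \<notin> tm_vars (\<sigma> b)"
    using exists_var_avoiding_msubst[where A = A and \<sigma> = \<sigma>] by blast
  have "lterm L ((\<sigma>(a := Var (Free c))) b)" for b
    using 5 by (auto intro: lterm.intros)
  then have "formula L (fm_msubst (\<sigma>(a := Var (Free c))) A)"
    and "Bnd x \<notin> fm_vars (fm_msubst (\<sigma>(a := Var (Free c))) A)"
    using 5 fm_vars_msubst[of "Bnd x" "\<sigma>(a := Var (Free c))" A] lterm_no_Bnd[of L _ x] by blast+
  then show ?case
    using c by (subst fm_msubst.simps, subst fm_msubst_close[of _ c]) (auto intro: formula.intros)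
qed (auto intro: formula.intros)

lemma formula_Imp_iff [simp]: "formula L (Imp A B) \<longleftrightarrow> formula L A \<and> formula L B"
  by (auto intro: formula.intros elim: formula.cases)

lemma formula_instance:
  assumes "formula L (All x A) \<or> formula L (Ex x A)" and "lterm L t"
  shows "formula L (subst (Bnd x) t A)"
proof -
  obtain B a where "A = subst (Free a) (Var (Bnd x)) B" "formula L B" "Bnd x \<notin> fm_vars B"
    using assms(1) by (auto elim: formula.cases)
  then show ?thesis
    using assms(2) by (auto simp: subst_subst_eq_msubst intro!: formula_msubst lterm.intros)
qed

section \<open>Renaming of derivations\<close>

abbreviation rename :: "(nat \<Rightarrow> nat) \<Rightarrow> ('p, 'f) fm \<Rightarrow> ('p, 'f) fm" where
  "rename \<pi> \<equiv> fm_msubst (\<lambda>a. Var (Free (\<pi> a)))"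

abbreviation rename_sequent :: "(nat \<Rightarrow> nat) \<Rightarrow> ('p, 'f) sequent \<Rightarrow> ('p, 'f) sequent" where
  "rename_sequent \<pi> \<equiv> map_prod (image_mset (rename \<pi>)) (image_mset (rename \<pi>))"

lemma is_sequent_Pair [simp]:
  "is_sequent L (\<Gamma>, \<Delta>) \<longleftrightarrow> (\<forall>A \<in># \<Gamma>. formula L A) \<and> (\<forall>A \<in># \<Delta>. formula L A)"
  by (auto simp: is_sequent_def)

lemma is_hypersequent_simps [simp]:
  "is_hypersequent L {#}"
  "is_hypersequent L (add_mset S H) \<longleftrightarrow> is_sequent L S \<and> is_hypersequent L H"
  "is_hypersequent L (H + K) \<longleftrightarrow> is_hypersequent L H \<and> is_hypersequent L K"
  by (auto simp: is_hypersequent_def)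

lemma formula_Bot [simp]: "formula L Bot"
  by (rule formula.intros)

lemma lterm_Free [simp]: "lterm L (Var (Free a))"
  by (rule lterm.intros)

lemma rename_sequent_is_sequent: "is_sequent L S \<Longrightarrow> is_sequent L (rename_sequent \<pi> S)"
  by (cases S) (auto intro!: formula_msubst)

lemma rename_is_hypersequent:
  "is_hypersequent L H \<Longrightarrow> is_hypersequent L (image_mset (rename_sequent \<pi>) H)"
  unfolding is_hypersequent_def by (auto intro: rename_sequent_is_sequent)

lemma Free_in_rename:
  "Free b \<in> fm_vars (rename \<pi> A) \<Longrightarrow> \<exists>a. b = \<pi> a \<and> Free a \<in> fm_vars A"
  using fm_vars_msubst[of "Free b" "\<lambda>a. Var (Free (\<pi> a))" A] by auto

lemma rename_fresh:
  assumes "inj \<pi>" and "Free a \<notin> hypersequent_vars H"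
  shows "Free (\<pi> a) \<notin> hypersequent_vars (image_mset (rename_sequent \<pi>) H)"
  using assms by (auto simp: hypersequent_vars_def dest!: Free_in_rename injD[OF assms(1)])

lemma rename_instance:
  "rename \<pi> (subst (Bnd x) s A) = subst (Bnd x) (tm_msubst (\<lambda>a. Var (Free (\<pi> a))) s) (rename \<pi> A)"
  by (rule fm_msubst_subst) simp

text \<open>
  The calculus does not distinguish between free variables, so a derivation can be renamed as a whole.
  Injectivity keeps an eigenvariable distinct from the variables of the conclusion.
\<close>

lemma GL_rule_rename:
  assumes "inj \<pi>" and "GL_rule L Ps H"
  shows "GL_rule L (map (image_mset (rename_sequent \<pi>)) Ps) (image_mset (rename_sequent \<pi>) H)"
  using assms(2)
proof cases
  case (All_left t G \<Gamma> x A \<Delta>)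
  then show ?thesis
    by (simp add: rename_instance)
       (use GL_rule.All_left[of L "tm_msubst (\<lambda>a. Var (Free (\<pi> a))) t"] lterm_msubst in fastforce)
next
  case (Ex_right t G \<Gamma> x A \<Delta>)
  then show ?thesis
    by (simp add: rename_instance)
       (use GL_rule.Ex_right[of L "tm_msubst (\<lambda>a. Var (Free (\<pi> a))) t"] lterm_msubst in fastforce)
next
  case (All_right a G \<Gamma> x A \<Delta>)
  then show ?thesis
    using GL_rule.All_right[of "\<pi> a" "image_mset (rename_sequent \<pi>) G" "image_mset (rename \<pi>) \<Gamma>" x
        "rename \<pi> A" "image_mset (rename \<pi>) \<Delta>"] rename_fresh[OF assms(1), of a H]
    by (simp add: rename_instance)
next
  case (Ex_left a G \<Gamma> x A \<Delta>)
  then show ?thesis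
    using GL_rule.Ex_left[of "\<pi> a" "image_mset (rename_sequent \<pi>) G" "image_mset (rename \<pi>) \<Gamma>" x
        "rename \<pi> A" "image_mset (rename \<pi>) \<Delta>"] rename_fresh[OF assms(1), of a H]
    by (simp add: rename_instance)
qed (simp, use GL_rule.intros[where L = L] in \<open>simp; fail\<close>)+

lemma GL_derivable_rename:
  assumes "inj \<pi>" and "GL_derivable L H"
  shows "GL_derivable L (image_mset (rename_sequent \<pi>) H)"
  using assms(2)
proof (induction rule: GL_derivable.induct)
  case (1 Ps H)
  then show ?case
    by (intro GL_derivable.intros[OF GL_rule_rename[OF assms(1) 1(1)]])
       (auto intro: rename_is_hypersequent)
qed

section \<open>Derived structural rules\<close>

lemma GL_intro:
  assumes "GL_rule L Ps H" and "is_hypersequent L H" and "\<And>P. P \<in> set Ps \<Longrightarrow> GL_derivable L P"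
  shows "GL_derivable L H"
  using assms by (auto intro: GL_derivable.intros)

lemma GL_derivable_is_hypersequent: "GL_derivable L H \<Longrightarrow> is_hypersequent L H"
  by (auto elim: GL_derivable.cases)

lemma GL_derivable_nonempty: "GL_derivable L H \<Longrightarrow> H \<noteq> {#}"
  by (erule GL_derivable.cases) (auto elim!: GL_rule.cases)

lemma GL_external_weakening:
  "GL_derivable L H \<Longrightarrow> is_hypersequent L K \<Longrightarrow> GL_derivable L (H + K)"
proof (induction K)
  case (add S K)
  moreover obtain \<Gamma> \<Delta> where "S = (\<Gamma>, \<Delta>)" by (cases S)
  ultimately show ?case
    using GL_intro[OF GL_rule.EW[of "H + K" L \<Gamma> \<Delta>]] GL_derivable_nonempty[of L "H + K"]
      GL_derivable_is_hypersequent[of L "H + K"]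
    by auto
qed simp

lemma GL_external_contraction:
  "GL_derivable L (H + K) \<Longrightarrow> set_mset K \<subseteq> set_mset H \<Longrightarrow> GL_derivable L H"
proof (induction K)
  case (add S K)
  obtain \<Gamma> \<Delta> where S: "S = (\<Gamma>, \<Delta>)" by (cases S)
  obtain H' where H': "H = add_mset S H'"
    using add.prems by (metis insert_subset set_mset_add_mset_insert multi_member_split)
  have "GL_derivable L (H + K)"
    using GL_intro[OF GL_rule.EC[of L "H' + K" \<Gamma> \<Delta>]] add.prems
      GL_derivable_is_hypersequent[OF add.prems(1)]
    by (simp add: H' S)
  then show ?case using add by simp
qed simp

text \<open>Only the set of sequents in a hypersequent matters, by external weakening and contraction.\<close>

lemma GL_derivable_mono:
  assumes "GL_derivable L H" and "set_mset H \<subseteq> set_mset H'" and "is_hypersequent L H'"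
  shows "GL_derivable L H'"
  using GL_external_contraction[of L H' H] GL_external_weakening[OF assms(1,3)] assms(2)
  by (simp add: add.commute)

lemma GL_mix:
  assumes "GL_derivable L {#(\<Gamma>1, \<Delta>1)#}" and "GL_derivable L {#(\<Gamma>2, \<Delta>2)#}"
  shows "GL_derivable L {#(\<Gamma>1 + \<Gamma>2, \<Delta>1 + \<Delta>2)#}"
  using GL_intro[OF GL_rule.M[of L "{#}" \<Gamma>1 \<Delta>1 \<Gamma>2 \<Delta>2]] assms
    assms[THEN GL_derivable_is_hypersequent]
  by auto

lemma GL_internal_weakening:
  "GL_derivable L {#(\<Gamma>, \<Delta>)#} \<Longrightarrow> \<forall>A \<in># \<Gamma>'. formula L A \<Longrightarrow> GL_derivable L {#(\<Gamma> + \<Gamma>', \<Delta>)#}"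
proof (induction \<Gamma>')
  case (add A \<Gamma>')
  then have d: "GL_derivable L {#(\<Gamma> + \<Gamma>', \<Delta>)#}" by simp
  show ?case
    using GL_intro[OF GL_rule.IW[of L "{#}" "\<Gamma> + \<Gamma>'" \<Delta> A]] d GL_derivable_is_hypersequent[OF d] add.prems
    by auto
qed simp

text \<open>
  The splitting rule read upwards: to derive a hypersequent it suffices to derive the sum of its
  components. Together with external contraction, which makes multiplicities free, this turns linear
  dependencies between sequents into derivations.
\<close>

lemma GL_split:
  assumes "GL_derivable L (add_mset (\<Sum>S\<in>#M. fst S, \<Sum>S\<in>#M. snd S) G)" and "M \<noteq> {#}"
    and "is_hypersequent L M"
  shows "GL_derivable L (M + G)"
  using assms(2,1,3)
proof (induction M arbitrary: G)
  case empty then show ?case by simp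
next
  case (add S M)
  obtain \<Gamma> \<Delta> where S: "S = (\<Gamma>, \<Delta>)" by (cases S)
  show ?case
  proof (cases "M = {#}")
    case True
    then show ?thesis using add.prems S by simp
  next
    case False
    have "is_sequent L (\<Sum>S\<in>#M. fst S, \<Sum>S\<in>#M. snd S)"
      using add.prems GL_derivable_is_hypersequent[OF add.prems(2)] S by auto
    then have "GL_derivable L (G + {#(\<Gamma>, \<Delta>), (\<Sum>S\<in>#M. fst S, \<Sum>S\<in>#M. snd S)#})"
      using add.prems GL_derivable_is_hypersequent[OF add.prems(2)]
      by (intro GL_intro[OF GL_rule.S]) (auto simp: S)
    then have "GL_derivable L (add_mset (\<Sum>S\<in>#M. fst S, \<Sum>S\<in>#M. snd S) (add_mset S G))"
      by (simp add: S add_mset_commute)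
    from add.IH[OF False this] show ?thesis
      using add.prems by simp
  qed
qed

lemma GL_identity: "\<forall>A \<in># \<Gamma>. formula L A \<Longrightarrow> GL_derivable L {#(\<Gamma>, \<Gamma>)#}"
proof (induction \<Gamma>)
  case empty
  show ?case by (rule GL_intro[OF GL_rule.EMP]) auto
next
  case (add A \<Gamma>)
  have "GL_derivable L {#({#A#}, {#A#})#}"
    using add by (intro GL_intro[OF GL_rule.ID]) auto
  from GL_mix[OF this, of \<Gamma> \<Gamma>] show ?case using add by simp
qed

lemma GL_explosion:
  "\<forall>A \<in># \<Delta>. formula L A \<Longrightarrow> GL_derivable L {#(replicate_mset (size \<Delta>) Bot, \<Delta>)#}"
proof (induction \<Delta>)
  case empty
  show ?case by (simp, rule GL_intro[OF GL_rule.EMP]) auto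
next
  case (add A \<Delta>)
  have "GL_derivable L {#({#Bot#}, {#A#})#}"
    using add by (intro GL_intro[OF GL_rule.BOT]) auto
  from GL_mix[OF this, of "replicate_mset (size \<Delta>) Bot" \<Delta>] show ?case using add by simp
qed

section \<open>Gordan's theorem\<close>

lemma between_finite_families:
  fixes f g :: "'a \<Rightarrow> real"
  assumes "finite I" "finite J" and "\<And>i j. i \<in> I \<Longrightarrow> j \<in> J \<Longrightarrow> f i < g j"
  shows "\<exists>x. (\<forall>i\<in>I. f i < x) \<and> (\<forall>j\<in>J. x < g j)"
proof (cases "I = {} \<or> J = {}")
  case True
  obtain b where b: "\<forall>i\<in>I. f i \<le> b"
    using bdd_above_finite[of "f ` I"] assms(1) by (auto simp: bdd_above_def)
  obtain c where c: "\<forall>j\<in>J. c \<le> g j"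
    using bdd_below_finite[of "g ` J"] assms(2) by (auto simp: bdd_below_def)
  show ?thesis
  proof (cases "I = {}")
    case True
    then show ?thesis using c by (intro exI[of _ "c - 1"]) force
  next
    case False
    then have "J = {}" using True by blast
    then show ?thesis using b by (intro exI[of _ "b + 1"]) force
  qed
next
  case False
  then have "Max (f ` I) < Min (g ` J)" using assms by simp
  then obtain x where "Max (f ` I) < x" "x < Min (g ` J)" using dense by blast
  then show ?thesis using False assms(1,2) by auto
qed

text \<open>
  Traces a dependency between combinations of vectors back to the vectors that were combined.
\<close>

lemma combine_multisets:
  fixes F :: "('v \<Rightarrow> int) set"
  assumes "M \<noteq> {#}"
    and "\<And>f. f \<in># M \<Longrightarrow> \<exists>N. N \<noteq> {#} \<and> set_mset N \<subseteq> F \<and> (\<forall>q. f q = (\<Sum>g\<in>#N. g q))"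
  shows "\<exists>N. N \<noteq> {#} \<and> set_mset N \<subseteq> F \<and> (\<forall>q. (\<Sum>f\<in>#M. f q) = (\<Sum>g\<in>#N. g q))"
  using assms
proof (induction M)
  case (add f M)
  obtain N where N: "N \<noteq> {#}" "set_mset N \<subseteq> F" "\<And>q. f q = (\<Sum>g\<in>#N. g q)"
    using add.prems(2)[of f] by auto
  show ?case
  proof (cases "M = {#}")
    case True
    then show ?thesis using N by (auto intro!: exI[of _ N])
  next
    case False
    then obtain N' where "N' \<noteq> {#}" "set_mset N' \<subseteq> F" "\<And>q. (\<Sum>f\<in>#M. f q) = (\<Sum>g\<in>#N'. g q)"
      using add.IH add.prems(2) by auto
    then show ?thesis using N by (auto intro!: exI[of _ "N + N'"])
  qed
qed simp

text \<open>
  Theorem of the alternative for systems of strict homogeneous inequalities, by Fourier--Motzkin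
  elimination of one coordinate \<open>p\<close> at a time. Vectors with opposite signs at \<open>p\<close> are combined so
  that \<open>p\<close> cancels; a solution of the eliminated system extends to \<open>p\<close> because these combinations say
  that each lower bound for the value at \<open>p\<close> lies below each upper bound. The nonnegative
  coefficients of a dependency are integers here and are encoded as the multiplicities of a multiset,
  since they will become multiplicities of sequents in a hypersequent.
\<close>

theorem gordan:
  fixes F :: "('v \<Rightarrow> int) set"
  assumes "finite V" "finite F"
  shows "(\<exists>u :: 'v \<Rightarrow> real. \<forall>f\<in>F. 0 < (\<Sum>p\<in>V. of_int (f p) * u p)) \<or>
    (\<exists>M. M \<noteq> {#} \<and> set_mset M \<subseteq> F \<and> (\<forall>p\<in>V. (\<Sum>f\<in>#M. f p) = 0))"
  using assms
proof (induction V arbitrary: F rule: finite_induct)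
  case empty
  show ?case
  proof (cases "F = {}")
    case False
    then obtain f where "f \<in> F" by blast
    then show ?thesis by (auto intro!: exI[of _ "{#f#}"])
  qed simp
next
  case (insert p V)
  define c where "c = (\<lambda>(f :: 'v \<Rightarrow> int, g :: 'v \<Rightarrow> int) q. (- g p) * f q + f p * g q)"
  define P where "P = {f \<in> F. 0 < f p}"
  define N where "N = {f \<in> F. f p < 0}"
  define F' where "F' = {f \<in> F. f p = 0} \<union> c ` (P \<times> N)"
  have fin: "finite P" "finite N" "finite F'"
    using insert.prems by (auto simp: F'_def P_def N_def)
  from insert.IH[OF fin(3)] show ?case
  proof
    assume "\<exists>u :: 'v \<Rightarrow> real. \<forall>f\<in>F'. 0 < (\<Sum>q\<in>V. of_int (f q) * u q)"
    then obtain u :: "'v \<Rightarrow> real" where u: "\<And>f. f \<in> F' \<Longrightarrow> 0 < (\<Sum>q\<in>V. of_int (f q) * u q)"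
      by blast
    define l where "l f = (\<Sum>q\<in>V. of_int (f q) * u q)" for f :: "'v \<Rightarrow> int"
    have lt: "- l f / f p < - l g / g p" if "f \<in> P" "g \<in> N" for f g
    proof -
      have "0 < l (c (f, g))"
        using u[of "c (f, g)"] that by (auto simp: F'_def l_def)
      also have "l (c (f, g)) = - g p * l f + f p * l g"
        by (simp add: l_def c_def sum_distrib_left sum.distrib [symmetric] algebra_simps
            flip: sum_subtractf)
      finally show ?thesis
        using that by (auto simp: P_def N_def field_simps)
    qed
    obtain x where x: "\<And>f. f \<in> P \<Longrightarrow> - l f / f p < x" "\<And>g. g \<in> N \<Longrightarrow> x < - l g / g p"
      using between_finite_families[OF fin(1,2), of "\<lambda>f. - l f / f p" "\<lambda>g. - l g / g p", OF lt]
      by metis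
    have "0 < (\<Sum>q\<in>insert p V. of_int (f q) * (u(p := x)) q)" if f: "f \<in> F" for f
    proof -
      have "(\<Sum>q\<in>insert p V. of_int (f q) * (u(p := x)) q) = f p * x + l f"
        using insert.hyps by (auto simp: l_def intro!: sum.cong)
      also have "0 < f p * x + l f"
      proof -
        consider "f \<in> P" | "f \<in> N" | "f p = 0"
          using f unfolding P_def N_def by (metis (mono_tags, lifting) mem_Collect_eq linorder_neqE)
        then show ?thesis
        proof cases
          case 1
          then show ?thesis using x(1)[OF 1] by (auto simp: P_def field_simps)
        next
          case 2
          then show ?thesis using x(2)[OF 2] by (auto simp: N_def field_simps)
        next
          case 3
          then show ?thesis using u[of f] f by (auto simp: F'_def l_def)
        qed
      qed
      finally show ?thesis .
    qed
    then show ?thesis by blast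
  next
    assume "\<exists>M. M \<noteq> {#} \<and> set_mset M \<subseteq> F' \<and> (\<forall>q\<in>V. (\<Sum>f\<in>#M. f q) = 0)"
    then obtain M where M: "M \<noteq> {#}" "set_mset M \<subseteq> F'" "\<And>q. q \<in> V \<Longrightarrow> (\<Sum>f\<in>#M. f q) = 0"
      by blast
    have "f p = 0" if "f \<in># M" for f
      using that M(2) by (auto simp: F'_def c_def)
    then have "(\<Sum>f\<in>#M. f p) = 0"
      by (intro sum_mset.neutral) auto
    moreover have "\<exists>K. K \<noteq> {#} \<and> set_mset K \<subseteq> F \<and> (\<forall>q. f q = (\<Sum>g\<in>#K. g q))" if "f \<in># M" for f
    proof -
      have "f \<in> F'" using that M(2) by blast
      then consider "f \<in> F" | g h where "g \<in> P" "h \<in> N" "f = c (g, h)"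
        by (auto simp: F'_def)
      then show ?thesis
      proof cases
        case 1
        then show ?thesis by (auto intro!: exI[of _ "{#f#}"])
      next
        case (2 g h)
        then show ?thesis
          by (intro exI[of _ "replicate_mset (nat (- h p)) g + replicate_mset (nat (g p)) h"])
             (auto simp: P_def N_def c_def)
      qed
    qed
    ultimately show ?thesis
      using combine_multisets[OF M(1), of F] M(3) by auto
  qed
qed

section \<open>Valuations of underivable hypersequents\<close>

definition weight :: "('a \<Rightarrow> real) \<Rightarrow> 'a multiset \<times> 'a multiset \<Rightarrow> real" where
  "weight v S = (\<Sum>A\<in>#snd S. v A) - (\<Sum>A\<in>#fst S. v A)"

text \<open>
  All formulas are treated as atoms here, except that \<open>Bot\<close> has its value 1. The meaning of the
  connectives and quantifiers is recovered from saturation, later.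
\<close>

definition valuations :: "(('p, 'f) fm \<Rightarrow> real) set" where
  "valuations = {v. v Bot = 1 \<and> (\<forall>A. 0 \<le> v A \<and> v A \<le> 1)}"

lemma sum_mset_eq_sum_count:
  fixes v :: "'a \<Rightarrow> real"
  assumes "finite V" and "set_mset M \<subseteq> V"
  shows "(\<Sum>A\<in>#M. v A) = (\<Sum>A\<in>V. of_nat (count M A) * v A)"
  using assms(2)
proof (induction M)
  case (add B M)
  have "(\<Sum>A\<in>V. of_nat (count (add_mset B M) A) * v A) =
        (\<Sum>A\<in>V. of_nat (count M A) * v A + (if A = B then v A else 0))"
    by (rule sum.cong) (auto simp: algebra_simps)
  also have "\<dots> = (\<Sum>A\<in>V. of_nat (count M A) * v A) + v B"
    using add.prems assms(1) by (simp add: sum.distrib)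
  finally show ?case using add by simp
qed simp

lemma weight_eq_sum:
  assumes "finite V" and "set_mset (fst S) \<subseteq> V" and "set_mset (snd S) \<subseteq> V"
  shows "weight v S = (\<Sum>A\<in>V. of_int (int (count (snd S) A) - int (count (fst S) A)) * v A)"
  unfolding weight_def sum_mset_eq_sum_count[OF assms(1,2)] sum_mset_eq_sum_count[OF assms(1,3)]
  by (simp add: algebra_simps sum_subtractf)

lemma sum_mset_weight: "(\<Sum>S\<in>#M. weight v S) = weight v (\<Sum>S\<in>#M. fst S, \<Sum>S\<in>#M. snd S)"
  by (induction M) (auto simp: weight_def)

text \<open>
  If no valuation falsifies a sequent, then this holds in particular for the valuation that, after
  cancelling common formulas, makes the succedent false and all of the antecedent but \<open>Bot\<close> true;
  so there is a \<open>Bot\<close> on the left for each formula on the right.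
\<close>

lemma GL_derivable_if_weight_nonpos:
  assumes "is_sequent L (\<Gamma>, \<Delta>)" and "\<And>v. v \<in> valuations \<Longrightarrow> weight v (\<Gamma>, \<Delta>) \<le> 0"
  shows "GL_derivable L {#(\<Gamma>, \<Delta>)#}"
proof -
  define D where "D = \<Gamma> \<inter># \<Delta>"
  define \<Gamma>' where "\<Gamma>' = \<Gamma> - D"
  define \<Delta>' where "\<Delta>' = \<Delta> - D"
  have eq: "\<Gamma> = D + \<Gamma>'" "\<Delta> = D + \<Delta>'"
    by (auto simp: D_def \<Gamma>'_def \<Delta>'_def multiset_eq_iff)
  have disj: "A \<notin># \<Delta>'" if "A \<in># \<Gamma>'" for A
    using that by (auto simp: D_def \<Gamma>'_def \<Delta>'_def in_diff_count)
  define v where "v A = (if A \<in># \<Delta>' \<or> A = Bot then 1 else 0 :: real)" for A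
  have "v \<in> valuations" by (auto simp: valuations_def v_def)
  then have "weight v (\<Gamma>, \<Delta>) \<le> 0" by (rule assms(2))
  moreover have "(\<Sum>A\<in>#\<Delta>'. v A) = (\<Sum>A\<in>#\<Delta>'. 1)"
    by (rule arg_cong[of _ _ sum_mset], rule image_mset_cong) (simp add: v_def)
  moreover have "(\<Sum>A\<in>#\<Gamma>'. v A) = (\<Sum>A\<in>#\<Gamma>'. if A = Bot then 1 else 0)"
    by (rule arg_cong[of _ _ sum_mset], rule image_mset_cong) (auto simp: v_def dest: disj)
  ultimately have "real (size \<Delta>') \<le> (\<Sum>A\<in>#\<Gamma>'. if A = Bot then 1 else 0)"
    by (simp add: weight_def eq)
  also have "\<dots> = real (count \<Gamma>' Bot)"
    by (induction \<Gamma>') auto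
  finally have "replicate_mset (size \<Delta>') Bot \<subseteq># \<Gamma>'"
    by (simp add: count_le_replicate_mset_subset_eq)
  then obtain \<Gamma>'' where \<Gamma>'': "\<Gamma>' = replicate_mset (size \<Delta>') Bot + \<Gamma>''"
    by (auto simp: subseteq_mset_def[symmetric] mset_subset_eq_exists_conv)
  have "GL_derivable L {#(D + replicate_mset (size \<Delta>') Bot, D + \<Delta>')#}"
    using assms(1) eq by (intro GL_mix GL_identity GL_explosion) auto
  from GL_internal_weakening[OF this, of \<Gamma>'']
  have "GL_derivable L {#(D + replicate_mset (size \<Delta>') Bot + \<Gamma>'', D + \<Delta>')#}"
    using assms(1) eq \<Gamma>'' by auto
  then show ?thesis by (simp add: eq \<Gamma>'' add.assoc)
qed

lemma multiset_of_image:
  assumes "set_mset M \<subseteq> f ` Q"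
  obtains N where "set_mset N \<subseteq> Q" and "M = image_mset f N"
proof
  show "set_mset (image_mset (inv_into Q f) M) \<subseteq> Q"
    using assms by (auto intro: inv_into_into)
  have "image_mset f (image_mset (inv_into Q f) M) = image_mset id M"
    unfolding image_mset.compositionality
    using assms by (intro image_mset_cong) (auto simp: f_inv_into_f)
  then show "M = image_mset f (image_mset (inv_into Q f) M)" by simp
qed

lemma sum_mset_pos:
  fixes w :: "'a \<Rightarrow> real"
  shows "(\<And>x. x \<in># M \<Longrightarrow> 0 < w x) \<Longrightarrow> M \<noteq> {#} \<Longrightarrow> 0 < (\<Sum>x\<in>#M. w x)"
proof (induction M)
  case (add x M)
  then show ?case by (cases "M = {#}") (auto intro: add_pos_pos)
qed simp

text \<open>
  Gordan's theorem is applied to the vectors of the sequents of \<open>Q\<close> together with the constraints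
  \<open>v A > 0\<close> and \<open>v Bot - v A > 0\<close>. The inequalities are homogeneous, with \<open>Bot\<close> in the place of the
  constant 1, so a solution is a valuation after division by its value at \<open>Bot\<close>.
\<close>

lemma valuation_alternative:
  fixes Q :: "('p, 'f) sequent set"
  assumes "finite Q"
  shows "(\<exists>v \<in> valuations. \<forall>S\<in>Q. 0 \<le> weight v S) \<or>
    (\<exists>M. M \<noteq> {#} \<and> set_mset M \<subseteq> Q \<and> (\<forall>v \<in> valuations. (\<Sum>S\<in>#M. weight v S) \<le> 0))"
proof -
  define V where "V = insert Bot (\<Union>S\<in>Q. set_mset (fst S) \<union> set_mset (snd S))"
  define vec :: "('p, 'f) sequent \<Rightarrow> ('p, 'f) fm \<Rightarrow> int"
    where "vec S A = int (count (snd S) A) - int (count (fst S) A)" for S A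
  define unit :: "('p, 'f) fm \<Rightarrow> ('p, 'f) fm \<Rightarrow> int" where "unit B A = (if A = B then 1 else 0)" for B A
  define co :: "('p, 'f) fm \<Rightarrow> ('p, 'f) fm \<Rightarrow> int" where "co B A = unit Bot A - unit B A" for B A
  define U where "U = unit ` V \<union> co ` (V - {Bot})"
  define ev where "ev v f = (\<Sum>A\<in>V. of_int (f A) * v A)" for v :: "('p, 'f) fm \<Rightarrow> real" and f :: "('p, 'f) fm \<Rightarrow> int"
  have V: "finite V" "Bot \<in> V" using assms by (auto simp: V_def)
  have ev_unit: "ev v (unit B) = v B" if "B \<in> V" for v B
  proof -
    have "ev v (unit B) = (\<Sum>A\<in>V. if A = B then v A else 0)"
      unfolding ev_def unit_def by (rule sum.cong) auto
    then show ?thesis using that V by simp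
  qed
  have ev_co: "ev v (co B) = v Bot - v B" if "B \<in> V" for v B
  proof -
    have "ev v (co B) = ev v (unit Bot) - ev v (unit B)"
      by (simp add: ev_def co_def algebra_simps sum_subtractf)
    then show ?thesis using that V ev_unit by simp
  qed
  have ev_vec: "ev v (vec S) = weight v S" if "S \<in> Q" for v S
  proof -
    have "set_mset (fst S) \<subseteq> V" "set_mset (snd S) \<subseteq> V" using that by (auto simp: V_def)
    from weight_eq_sum[OF V(1) this] show ?thesis by (simp add: ev_def vec_def)
  qed
  have "finite (vec ` Q \<union> U)" using assms V by (auto simp: U_def)
  from gordan[OF V(1) this] show ?thesis
  proof
    assume "\<exists>u :: ('p, 'f) fm \<Rightarrow> real. \<forall>f\<in>vec ` Q \<union> U. 0 < (\<Sum>p\<in>V. of_int (f p) * u p)"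
    then obtain u where u: "\<And>f. f \<in> vec ` Q \<union> U \<Longrightarrow> 0 < ev u f"
      by (auto simp: ev_def)
    have pos: "0 < u B" if "B \<in> V" for B
      using u[of "unit B"] that ev_unit[of B u] by (auto simp: U_def)
    have le: "u B \<le> u Bot" if "B \<in> V" for B
      using u[of "co B"] that ev_co[of B u] by (cases "B = Bot") (auto simp: U_def)
    define v where "v A = (if A \<in> V then u A / u Bot else 0)" for A
    have "v \<in> valuations"
      using pos le V(2) by (auto simp: valuations_def v_def less_imp_le dest: pos)
    moreover have "0 \<le> weight v S" if "S \<in> Q" for S
    proof -
      have "weight v S = ev v (vec S)" by (simp add: ev_vec that)
      also have "\<dots> = ev u (vec S) / u Bot"
        unfolding ev_def sum_divide_distrib by (rule sum.cong) (auto simp: v_def)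
      also have "\<dots> \<ge> 0"
        using u[of "vec S"] that pos[OF V(2)] by auto
      finally show ?thesis .
    qed
    ultimately show ?thesis by blast
  next
    assume "\<exists>M. M \<noteq> {#} \<and> set_mset M \<subseteq> vec ` Q \<union> U \<and> (\<forall>p\<in>V. (\<Sum>f\<in>#M. f p) = 0)"
    then obtain M where M: "M \<noteq> {#}" "set_mset M \<subseteq> vec ` Q \<union> U" "\<And>p. p \<in> V \<Longrightarrow> (\<Sum>f\<in>#M. f p) = 0"
      by blast
    have "(\<Sum>f\<in>#M. ev v f) = (\<Sum>A\<in>V. of_int (\<Sum>f\<in>#M. f A) * v A)" for v
      unfolding ev_def by (induction M) (auto simp: sum.distrib algebra_simps)
    then have zero: "(\<Sum>f\<in>#M. ev v f) = 0" for v
      using M(3) by simp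
    define M1 where "M1 = filter_mset (\<lambda>f. f \<in> vec ` Q) M"
    define M2 where "M2 = filter_mset (\<lambda>f. f \<notin> vec ` Q) M"
    have M12: "M = M1 + M2" by (simp add: M1_def M2_def)
    have M2: "set_mset M2 \<subseteq> U" using M(2) by (auto simp: M2_def)
    obtain N where N: "set_mset N \<subseteq> Q" "M1 = image_mset vec N"
      using multiset_of_image[of M1 vec Q] by (auto simp: M1_def)
    \<comment> \<open>The constraints are consistent by themselves, as the constant valuation 1/2 shows.\<close>
    have "N \<noteq> {#}"
    proof
      assume "N = {#}"
      then have "set_mset M \<subseteq> U" using M12 N M2 by simp
      define v :: "('p, 'f) fm \<Rightarrow> real" where "v A = (if A = Bot then 1 else 1/2)" for A
      have "0 < ev v f" if "f \<in># M" for f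
      proof -
        have "f \<in> U" using that \<open>set_mset M \<subseteq> U\<close> by blast
        then show ?thesis
          by (auto simp: U_def ev_unit ev_co) (auto simp: v_def split: if_splits)
      qed
      from sum_mset_pos[of M "ev v", OF this M(1)] zero show False by simp
    qed
    moreover have "(\<Sum>S\<in>#N. weight v S) \<le> 0" if v: "v \<in> valuations" for v
    proof -
      have "0 \<le> ev v f" if "f \<in># M2" for f
      proof -
        have "f \<in> U" using that M2 by blast
        then show ?thesis
          using v by (auto simp: U_def ev_unit ev_co valuations_def)
      qed
      then have "0 \<le> (\<Sum>f\<in>#M2. ev v f)"
        by (induction M2) auto
      moreover have "(\<Sum>f\<in>#M1. ev v f) = (\<Sum>S\<in>#N. weight v S)"
        unfolding N(2) image_mset.compositionality
        using N(1) by (intro arg_cong[of _ _ sum_mset] image_mset_cong) (auto simp: ev_vec)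
      ultimately show ?thesis using zero[of v] by (simp add: M12)
    qed
    ultimately show ?thesis using N(1) by blast
  qed
qed

text \<open>
  Hypersequents over \<open>X\<close> may repeat sequents; as multiplicities are irrelevant for derivability, this
  says that no finite nonempty subset of \<open>X\<close> is derivable as a hypersequent.
\<close>

definition consistent :: "('p, 'f) language \<Rightarrow> ('p, 'f) sequent set \<Rightarrow> bool" where
  "consistent L X \<longleftrightarrow> (\<forall>S\<in>X. is_sequent L S) \<and> (\<forall>H. set_mset H \<subseteq> X \<longrightarrow> \<not> GL_derivable L H)"

text \<open>
  If no valuation made all sequents of \<open>Q\<close> nonnegative, some sum of sequents from \<open>Q\<close> would have
  nonpositive weight under every valuation. That sum is derivable, and the splitting rule turns its
  derivation into one of a hypersequent over \<open>Q\<close>.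
\<close>

lemma consistent_finite_valuation:
  assumes "consistent L X" and "finite Q" and "Q \<subseteq> X"
  shows "\<exists>v \<in> valuations. \<forall>S\<in>Q. 0 \<le> weight v S"
proof (rule ccontr)
  assume "\<not> ?thesis"
  then obtain M where M: "M \<noteq> {#}" "set_mset M \<subseteq> Q"
      "\<And>v. v \<in> valuations \<Longrightarrow> (\<Sum>S\<in>#M. weight v S) \<le> 0"
    using valuation_alternative[OF assms(2)] by blast
  have seq: "is_hypersequent L M"
    using M(2) assms(1,3) by (auto simp: consistent_def is_hypersequent_def)
  have "is_sequent L (\<Sum>S\<in>#M. fst S, \<Sum>S\<in>#M. snd S)"
    using seq by (force simp: is_hypersequent_def is_sequent_def)
  then have "GL_derivable L {#(\<Sum>S\<in>#M. fst S, \<Sum>S\<in>#M. snd S)#}"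
    using M(3) by (intro GL_derivable_if_weight_nonpos) (auto simp: sum_mset_weight)
  from GL_split[OF this M(1) seq] have "GL_derivable L M" by simp
  then show False using assms M(2) by (auto simp: consistent_def)
qed

text \<open>
  By Tychonoff's theorem. Passing to a limit of valuations preserves weak inequalities only; this is
  why the additional \<open>Bot\<close> of an approximation is essential for the model in the end.
\<close>

lemma compact_valuations: "compact (valuations :: (('p, 'f) fm \<Rightarrow> real) set)"
proof -
  have "valuations = (\<Pi>\<^sub>E (A :: ('p, 'f) fm)\<in>UNIV. if A = Bot then {1} else {0..1 :: real})"
    by (auto simp: valuations_def PiE_iff split: if_splits) (metis atLeastAtMost_iff order_refl singletonD zero_le_one)+
  moreover have "compactin (product_topology (\<lambda>A. euclidean) UNIV)
      (\<Pi>\<^sub>E (A :: ('p, 'f) fm)\<in>UNIV. if A = Bot then {1} else {0..1 :: real})"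
    by (subst compactin_PiE) auto
  ultimately show ?thesis by (simp add: euclidean_product_topology)
qed

lemma continuous_weight: "continuous_on UNIV (\<lambda>v. weight v S)"
proof -
  have "continuous_on UNIV (\<lambda>v. \<Sum>A\<in>#M. v A :: real)" for M :: "'a multiset"
    by (induction M) (auto intro!: continuous_intros)
  then show ?thesis unfolding weight_def by (intro continuous_intros)
qed

lemma consistent_valuation:
  assumes "consistent L X"
  shows "\<exists>v \<in> valuations. \<forall>S\<in>X. 0 \<le> weight v S"
proof -
  have "valuations \<inter> (\<Inter>S\<in>X. {v. 0 \<le> weight v S}) \<noteq> {}"
  proof (rule compact_imp_fip_image[OF compact_valuations])
    show "closed {v. 0 \<le> weight v S}" for S :: "('a, 'b) sequent"
      by (intro closed_Collect_le continuous_weight continuous_intros)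
    show "valuations \<inter> (\<Inter>S\<in>Q. {v. 0 \<le> weight v S}) \<noteq> {}" if "finite Q" "Q \<subseteq> X" for Q
      using consistent_finite_valuation[OF assms that] by blast
  qed
  then show ?thesis by blast
qed

section \<open>Saturation\<close>

text \<open>
  \<open>demand L S Ds\<close>: if \<open>S\<close> belongs to a saturated set, so must some element of \<open>Ds\<close>. These are the rules of
  the calculus read upwards: several premises become alternatives in \<open>Ds\<close>, whereas the two components
  in the premise of the left implication rule become separate demands. The choice of an eigenvariable
  also becomes a set of alternatives; only a variable that is new at the time can actually be chosen.
\<close>

inductive demand :: "('p, 'f) language \<Rightarrow> ('p, 'f) sequent \<Rightarrow> ('p, 'f) sequent set \<Rightarrow> bool" for L where
  Imp_left1: "demand L (add_mset (Imp A B) \<Gamma>, \<Delta>) {(\<Gamma>, \<Delta>)}"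
| Imp_left2: "demand L (add_mset (Imp A B) \<Gamma>, \<Delta>) {(add_mset B \<Gamma>, add_mset A \<Delta>)}"
| Imp_right: "demand L (\<Gamma>, add_mset (Imp A B) \<Delta>) {(\<Gamma>, \<Delta>), (add_mset A \<Gamma>, add_mset B \<Delta>)}"
| All_left: "lterm L t \<Longrightarrow> demand L (add_mset (All x A) \<Gamma>, \<Delta>) {(add_mset (subst (Bnd x) t A) \<Gamma>, \<Delta>)}"
| All_right:
    "demand L (\<Gamma>, add_mset (All x A) \<Delta>) (range (\<lambda>a. (\<Gamma>, add_mset (subst (Bnd x) (Var (Free a)) A) \<Delta>)))"
| Ex_left:
    "demand L (add_mset (Ex x A) \<Gamma>, \<Delta>) (range (\<lambda>a. (add_mset (subst (Bnd x) (Var (Free a)) A) \<Gamma>, \<Delta>)))"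
| Ex_right: "lterm L t \<Longrightarrow> demand L (\<Gamma>, add_mset (Ex x A) \<Delta>) {(\<Gamma>, add_mset (subst (Bnd x) t A) \<Delta>)}"

definition unused :: "('p, 'f) sequent set \<Rightarrow> nat set" where
  "unused X = {a. \<forall>S\<in>X. Free a \<notin> hypersequent_vars {#S#}}"

lemma unused_hypersequent: "a \<in> unused X \<Longrightarrow> set_mset H \<subseteq> X \<Longrightarrow> Free a \<notin> hypersequent_vars H"
  by (fastforce simp: unused_def hypersequent_vars_def)

lemma infinite_unused_insert:
  assumes "infinite (unused X)"
  shows "infinite (unused (insert S X))"
proof -
  have "finite (hypersequent_vars {#S#})"
    by (auto simp: hypersequent_vars_def)
  then have "finite (Free -` hypersequent_vars {#S#})"
    by (rule finite_vimageI) (simp add: inj_on_def)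
  moreover have "unused (insert S X) = unused X - Free -` hypersequent_vars {#S#}"
    by (auto simp: unused_def)
  ultimately show ?thesis using assms by simp
qed

lemma inconsistent_insertE:
  assumes "consistent L X" and "is_sequent L D" and "\<not> consistent L (insert D X)"
  obtains H where "set_mset H \<subseteq> X" and "is_hypersequent L H" and "GL_derivable L (add_mset D H)"
proof -
  obtain H where H: "set_mset H \<subseteq> insert D X" "GL_derivable L H"
    using assms by (auto simp: consistent_def)
  define K where "K = filter_mset (\<lambda>S. S \<noteq> D) H"
  have "set_mset K \<subseteq> X" using H(1) by (auto simp: K_def)
  moreover have "is_hypersequent L K"
    using \<open>set_mset K \<subseteq> X\<close> assms(1) by (auto simp: consistent_def is_hypersequent_def)
  moreover have "GL_derivable L (add_mset D K)"
    using assms(2) calculation by (intro GL_derivable_mono[OF H(2)]) (auto simp: K_def)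
  ultimately show ?thesis by (rule that)
qed

lemma consistentD: "consistent L X \<Longrightarrow> set_mset H \<subseteq> X \<Longrightarrow> GL_derivable L H \<Longrightarrow> False"
  by (auto simp: consistent_def)

text \<open>
  If every choice made \<open>X\<close> inconsistent, the rule belonging to the demand would derive a hypersequent
  over \<open>X\<close> from the derivations obtained. The principal sequent \<open>S\<close> remains in \<open>X\<close>, so a rule can be
  applied to it again, with another instance of a quantifier; this is external contraction.
\<close>

lemma consistent_extend:
  assumes con: "consistent L X" and S: "S \<in> X" and "demand L S Ds" and fresh: "infinite (unused X)"
  shows "\<exists>D\<in>Ds. consistent L (insert D X)"
proof (rule ccontr)
  assume neg: "\<not> ?thesis"
  have seq: "is_sequent L S" using con S by (auto simp: consistent_def)
  obtain a where a: "a \<in> unused X" using infinite_imp_nonempty[OF fresh] by blast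
  have inst: "\<And>x A t. lterm L t \<Longrightarrow> formula L (All x A) \<Longrightarrow> formula L (subst (Bnd x) t A)"
    "\<And>x A t. lterm L t \<Longrightarrow> formula L (Ex x A) \<Longrightarrow> formula L (subst (Bnd x) t A)"
    using formula_instance by blast+
  have refuted: "\<exists>H. set_mset H \<subseteq> X \<and> is_hypersequent L H \<and> GL_derivable L (add_mset D H)"
    if "is_sequent L D" "D \<in> Ds" for D
    using inconsistent_insertE[OF con that(1)] neg that(2) by blast
  have "\<exists>H. set_mset H \<subseteq> X \<and> GL_derivable L (add_mset S H)"
    using assms(3)
  proof cases
    case (Imp_left1 A B \<Gamma> \<Delta>)
    have "is_sequent L (\<Gamma>, \<Delta>)" using seq Imp_left1 by auto
    from refuted[OF this] obtain H where H: "set_mset H \<subseteq> X" "is_hypersequent L H" "GL_derivable L (add_mset (\<Gamma>, \<Delta>) H)"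
      using Imp_left1 by auto
    then have "GL_derivable L (H + {#(\<Gamma>, \<Delta>), (\<Gamma> + {#B#}, {#A#} + \<Delta>)#})"
      using seq Imp_left1 by (intro GL_derivable_mono[OF H(3)]) auto
    from GL_intro[OF GL_rule.Imp_left, of L H \<Gamma> A B \<Delta>] this show ?thesis
      using H seq Imp_left1 by auto
  next
    case (Imp_left2 A B \<Gamma> \<Delta>)
    have "is_sequent L (add_mset B \<Gamma>, add_mset A \<Delta>)" using seq Imp_left2 by auto
    from refuted[OF this] obtain H where H: "set_mset H \<subseteq> X" "is_hypersequent L H"
        "GL_derivable L (add_mset (add_mset B \<Gamma>, add_mset A \<Delta>) H)"
      using Imp_left2 by auto
    then have "GL_derivable L (H + {#(\<Gamma>, \<Delta>), (\<Gamma> + {#B#}, {#A#} + \<Delta>)#})"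
      using seq Imp_left2 by (intro GL_derivable_mono[OF H(3)]) auto
    from GL_intro[OF GL_rule.Imp_left, of L H \<Gamma> A B \<Delta>] this show ?thesis
      using H seq Imp_left2 by auto
  next
    case (Imp_right \<Gamma> A B \<Delta>)
    have 1: "is_sequent L (\<Gamma>, \<Delta>)" and 2: "is_sequent L (add_mset A \<Gamma>, add_mset B \<Delta>)"
      using seq Imp_right by auto
    obtain H K where
        H: "set_mset H \<subseteq> X" "is_hypersequent L H" "GL_derivable L (add_mset (\<Gamma>, \<Delta>) H)" and
        K: "set_mset K \<subseteq> X" "is_hypersequent L K"
          "GL_derivable L (add_mset (add_mset A \<Gamma>, add_mset B \<Delta>) K)"
      using refuted[OF 1] refuted[OF 2] Imp_right(2) by blast
    have "GL_derivable L (H + K + {#(\<Gamma>, \<Delta>)#})"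
      using seq Imp_right H K by (intro GL_derivable_mono[OF H(3)]) auto
    moreover have "GL_derivable L (H + K + {#(\<Gamma> + {#A#}, {#B#} + \<Delta>)#})"
      using seq Imp_right H K by (intro GL_derivable_mono[OF K(3)]) auto
    ultimately have "GL_derivable L (H + K + {#(\<Gamma>, {#Imp A B#} + \<Delta>)#})"
      using H K seq Imp_right by (intro GL_intro[OF GL_rule.Imp_right]) auto
    then show ?thesis
      using H K Imp_right by (intro exI[of _ "H + K"]) auto
  next
    case (All_left t x A \<Gamma> \<Delta>)
    then have "is_sequent L (add_mset (subst (Bnd x) t A) \<Gamma>, \<Delta>)" using seq inst by auto
    from refuted[OF this] obtain H where H: "set_mset H \<subseteq> X" "is_hypersequent L H"
        "GL_derivable L (add_mset (add_mset (subst (Bnd x) t A) \<Gamma>, \<Delta>) H)"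
      using All_left by auto
    then show ?thesis
      using GL_intro[OF GL_rule.All_left, of L t H \<Gamma> x A \<Delta>] seq All_left by auto
  next
    case (Ex_right t \<Gamma> x A \<Delta>)
    then have "is_sequent L (\<Gamma>, add_mset (subst (Bnd x) t A) \<Delta>)" using seq inst by auto
    from refuted[OF this] obtain H where H: "set_mset H \<subseteq> X" "is_hypersequent L H"
        "GL_derivable L (add_mset (\<Gamma>, add_mset (subst (Bnd x) t A) \<Delta>) H)"
      using Ex_right by auto
    then show ?thesis
      using GL_intro[OF GL_rule.Ex_right, of L t H \<Gamma> x A \<Delta>] seq Ex_right by auto
  next
    case (All_right \<Gamma> x A \<Delta>)
    then have "is_sequent L (\<Gamma>, add_mset (subst (Bnd x) (Var (Free a)) A) \<Delta>)" using seq inst by auto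
    from refuted[OF this] obtain H where H: "set_mset H \<subseteq> X" "is_hypersequent L H"
        "GL_derivable L (add_mset (\<Gamma>, add_mset (subst (Bnd x) (Var (Free a)) A) \<Delta>) H)"
      using All_right by auto
    moreover have "Free a \<notin> hypersequent_vars (H + {#(\<Gamma>, {#All x A#} + \<Delta>)#})"
      using a H(1) S All_right by (intro unused_hypersequent) auto
    ultimately show ?thesis
      using GL_intro[OF GL_rule.All_right, of a H \<Gamma> x A \<Delta> L] seq All_right by auto
  next
    case (Ex_left x A \<Gamma> \<Delta>)
    then have "is_sequent L (add_mset (subst (Bnd x) (Var (Free a)) A) \<Gamma>, \<Delta>)" using seq inst by auto
    from refuted[OF this] obtain H where H: "set_mset H \<subseteq> X" "is_hypersequent L H"
        "GL_derivable L (add_mset (add_mset (subst (Bnd x) (Var (Free a)) A) \<Gamma>, \<Delta>) H)"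
      using Ex_left by auto
    moreover have "Free a \<notin> hypersequent_vars (H + {#(\<Gamma> + {#Ex x A#}, \<Delta>)#})"
      using a H(1) S Ex_left by (intro unused_hypersequent) auto
    ultimately show ?thesis
      using GL_intro[OF GL_rule.Ex_left, of a H \<Gamma> x A \<Delta> L] seq Ex_left by auto
  qed
  then obtain H where "set_mset (add_mset S H) \<subseteq> X" "GL_derivable L (add_mset S H)"
    using S by auto
  then show False using con consistentD by blast
qed

section \<open>Countability of the syntax\<close>

instance var :: countable
  by countable_datatype

instance tm :: (countable) countable
  by countable_datatype

instance fm :: (countable, countable) countable
  by countable_datatype

lemma countable_exprs:
  assumes "countable P" and "countable F"
  shows "countable {A :: ('p, 'f) fm. set1_fm A \<subseteq> P \<and> set2_fm A \<subseteq> F}"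
proof -
  have "inj_on (map_fm (to_nat_on P) (to_nat_on F)) {A :: ('p, 'f) fm. set1_fm A \<subseteq> P \<and> set2_fm A \<subseteq> F}"
  proof (rule inj_onI)
    fix A B :: "('p, 'f) fm"
    assume A: "A \<in> {A. set1_fm A \<subseteq> P \<and> set2_fm A \<subseteq> F}" and B: "B \<in> {A. set1_fm A \<subseteq> P \<and> set2_fm A \<subseteq> F}"
      and eq: "map_fm (to_nat_on P) (to_nat_on F) A = map_fm (to_nat_on P) (to_nat_on F) B"
    show "A = B"
    proof (rule fm.inj_map_strong[OF _ _ eq])
      show "p = q" if "p \<in> set1_fm A" "q \<in> set1_fm B" "to_nat_on P p = to_nat_on P q" for p q
        using that A B inj_onD[OF inj_on_to_nat_on[OF assms(1)]] by blast
      show "f = g" if "f \<in> set2_fm A" "g \<in> set2_fm B" "to_nat_on F f = to_nat_on F g" for f g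
        using that A B inj_onD[OF inj_on_to_nat_on[OF assms(2)]] by blast
    qed
  qed
  then show ?thesis by (rule countableI')
qed

lemma countable_terms:
  assumes "countable F"
  shows "countable {t :: 'f tm. set_tm t \<subseteq> F}"
proof -
  have "inj_on (map_tm (to_nat_on F)) {t :: 'f tm. set_tm t \<subseteq> F}"
  proof (rule inj_onI)
    fix s t :: "'f tm"
    assume st: "s \<in> {t. set_tm t \<subseteq> F}" "t \<in> {t. set_tm t \<subseteq> F}"
      and eq: "map_tm (to_nat_on F) s = map_tm (to_nat_on F) t"
    show "s = t"
    proof (rule tm.inj_map_strong[OF _ eq])
      show "f = g" if "f \<in> set_tm s" "g \<in> set_tm t" "to_nat_on F f = to_nat_on F g" for f g
        using that st inj_onD[OF inj_on_to_nat_on[OF assms]] by blast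
    qed
  qed
  then show ?thesis by (rule countableI')
qed

lemma countable_multisets:
  assumes "countable E"
  shows "countable {M. set_mset M \<subseteq> E}"
proof -
  have "{M. set_mset M \<subseteq> E} \<subseteq> mset ` lists E"
  proof
    fix M assume "M \<in> {M. set_mset M \<subseteq> E}"
    moreover obtain xs where "M = mset xs" by (metis ex_mset)
    ultimately show "M \<in> mset ` lists E" by auto
  qed
  then show ?thesis
    by (rule countable_subset) (intro countable_image countable_lists assms)
qed

lemma lterm_symbols: "lterm L t \<Longrightarrow> set_tm t \<subseteq> funs L"
  by (induction rule: lterm.induct) auto

lemma set_tm_close: "set_tm (tm_subst v (Var w) t) = set_tm t"
  by (induction t) auto

lemma symbols_close:
  "set1_fm (subst v (Var w) A) = set1_fm A" "set2_fm (subst v (Var w) A) = set2_fm A"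
  by (induction A) (auto simp: set_tm_close)

lemma formula_symbols: "formula L A \<Longrightarrow> set1_fm A \<subseteq> preds L \<and> set2_fm A \<subseteq> funs L"
proof (induction rule: formula.induct)
  case (2 p ts)
  then show ?case using lterm_symbols by fastforce
qed (auto simp: symbols_close)

lemma countable_lterms: "countable_language L \<Longrightarrow> countable {t. lterm L t}"
  unfolding countable_language_def
  by (rule countable_subset[OF _ countable_terms[of "funs L"]]) (auto dest: lterm_symbols)

text \<open>
  A demand is determined by the parameters of its clause, which range over countable sets. The
  immediate parts of a quantified formula need not be formulas, so the parameters are taken from all
  expressions over the symbols of the language.
\<close>

lemma countable_demands:
  assumes "countable_language L"
  shows "countable {(S, Ds). is_sequent L S \<and> demand L S Ds}"
proof -
  define E where "E = {A. set1_fm A \<subseteq> preds L \<and> set2_fm A \<subseteq> funs L}"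
  define W where "W = {M. set_mset M \<subseteq> E}"
  define I where "I = W \<times> W \<times> E \<times> E \<times> (UNIV :: nat set) \<times> {t. lterm L t}"
  have "countable E" using assms unfolding E_def countable_language_def by (blast intro: countable_exprs)
  then have "countable I"
    unfolding I_def W_def
    by (intro countable_SIGMA countable_multisets countable_lterms[OF assms] countableI_type)
  have sub: "set_mset \<Gamma> \<subseteq> E \<and> set_mset \<Delta> \<subseteq> E" if "is_sequent L (\<Gamma>, \<Delta>)" for \<Gamma> \<Delta>
    using that formula_symbols by (fastforce simp: E_def)
  have E: "Imp A B \<in> E \<longleftrightarrow> A \<in> E \<and> B \<in> E" "All x A \<in> E \<longleftrightarrow> A \<in> E" "Ex x A \<in> E \<longleftrightarrow> A \<in> E" for A B x
    by (auto simp: E_def)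
  have "{(S, Ds). is_sequent L S \<and> demand L S Ds} \<subseteq>
      (\<lambda>(\<Gamma>, \<Delta>, A, B, x, t). ((add_mset (Imp A B) \<Gamma>, \<Delta>), {(\<Gamma>, \<Delta>)})) ` I \<union>
      (\<lambda>(\<Gamma>, \<Delta>, A, B, x, t). ((add_mset (Imp A B) \<Gamma>, \<Delta>), {(add_mset B \<Gamma>, add_mset A \<Delta>)})) ` I \<union>
      (\<lambda>(\<Gamma>, \<Delta>, A, B, x, t). ((\<Gamma>, add_mset (Imp A B) \<Delta>), {(\<Gamma>, \<Delta>), (add_mset A \<Gamma>, add_mset B \<Delta>)})) ` I \<union>
      (\<lambda>(\<Gamma>, \<Delta>, A, B, x, t). ((add_mset (All x A) \<Gamma>, \<Delta>), {(add_mset (subst (Bnd x) t A) \<Gamma>, \<Delta>)})) ` I \<union>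
      (\<lambda>(\<Gamma>, \<Delta>, A, B, x, t). ((\<Gamma>, add_mset (All x A) \<Delta>),
         range (\<lambda>a. (\<Gamma>, add_mset (subst (Bnd x) (Var (Free a)) A) \<Delta>)))) ` I \<union>
      (\<lambda>(\<Gamma>, \<Delta>, A, B, x, t). ((add_mset (Ex x A) \<Gamma>, \<Delta>),
         range (\<lambda>a. (add_mset (subst (Bnd x) (Var (Free a)) A) \<Gamma>, \<Delta>)))) ` I \<union>
      (\<lambda>(\<Gamma>, \<Delta>, A, B, x, t). ((\<Gamma>, add_mset (Ex x A) \<Delta>), {(\<Gamma>, add_mset (subst (Bnd x) t A) \<Delta>)})) ` I"
    (is "_ \<subseteq> ?f1 ` I \<union> ?f2 ` I \<union> ?f3 ` I \<union> ?f4 ` I \<union> ?f5 ` I \<union> ?f6 ` I \<union> ?f7 ` I")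
  proof (intro subsetI)
    fix p assume "p \<in> {(S, Ds). is_sequent L S \<and> demand L S Ds}"
    then obtain S Ds where p: "p = (S, Ds)" "is_sequent L S" "demand L S Ds" by blast
    from p(3) show "p \<in> ?f1 ` I \<union> ?f2 ` I \<union> ?f3 ` I \<union> ?f4 ` I \<union> ?f5 ` I \<union> ?f6 ` I \<union> ?f7 ` I"
    proof cases
      case (Imp_left1 A B \<Gamma> \<Delta>)
      then have "p = ?f1 (\<Gamma>, \<Delta>, A, B, 0, Var (Free 0))" "(\<Gamma>, \<Delta>, A, B, 0, Var (Free 0)) \<in> I"
        using p sub[of "add_mset (Imp A B) \<Gamma>" \<Delta>] by (auto simp: I_def W_def E)
      then show ?thesis by blast
    next
      case (Imp_left2 A B \<Gamma> \<Delta>)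
      then have "p = ?f2 (\<Gamma>, \<Delta>, A, B, 0, Var (Free 0))" "(\<Gamma>, \<Delta>, A, B, 0, Var (Free 0)) \<in> I"
        using p sub[of "add_mset (Imp A B) \<Gamma>" \<Delta>] by (auto simp: I_def W_def E)
      then show ?thesis by blast
    next
      case (Imp_right \<Gamma> A B \<Delta>)
      then have "p = ?f3 (\<Gamma>, \<Delta>, A, B, 0, Var (Free 0))" "(\<Gamma>, \<Delta>, A, B, 0, Var (Free 0)) \<in> I"
        using p sub[of \<Gamma> "add_mset (Imp A B) \<Delta>"] by (auto simp: I_def W_def E)
      then show ?thesis by blast
    next
      case (All_left t x A \<Gamma> \<Delta>)
      then have "p = ?f4 (\<Gamma>, \<Delta>, A, A, x, t)" "(\<Gamma>, \<Delta>, A, A, x, t) \<in> I"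
        using p sub[of "add_mset (All x A) \<Gamma>" \<Delta>] by (auto simp: I_def W_def E)
      then show ?thesis by blast
    next
      case (All_right \<Gamma> x A \<Delta>)
      then have "p = ?f5 (\<Gamma>, \<Delta>, A, A, x, Var (Free 0))" "(\<Gamma>, \<Delta>, A, A, x, Var (Free 0)) \<in> I"
        using p sub[of \<Gamma> "add_mset (All x A) \<Delta>"] by (auto simp: I_def W_def E)
      then show ?thesis by blast
    next
      case (Ex_left x A \<Gamma> \<Delta>)
      then have "p = ?f6 (\<Gamma>, \<Delta>, A, A, x, Var (Free 0))" "(\<Gamma>, \<Delta>, A, A, x, Var (Free 0)) \<in> I"
        using p sub[of "add_mset (Ex x A) \<Gamma>" \<Delta>] by (auto simp: I_def W_def E)
      then show ?thesis by blast
    next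
      case (Ex_right t \<Gamma> x A \<Delta>)
      then have "p = ?f7 (\<Gamma>, \<Delta>, A, A, x, t)" "(\<Gamma>, \<Delta>, A, A, x, t) \<in> I"
        using p sub[of \<Gamma> "add_mset (Ex x A) \<Delta>"] by (auto simp: I_def W_def E)
      then show ?thesis by blast
    qed
  qed
  then show ?thesis
    by (rule countable_subset) (intro countable_Un countable_image \<open>countable I\<close>)
qed

section \<open>Saturated extensions\<close>

definition saturated :: "('p, 'f) language \<Rightarrow> ('p, 'f) sequent set \<Rightarrow> bool" where
  "saturated L X \<longleftrightarrow> (\<forall>S\<in>X. \<forall>Ds. demand L S Ds \<longrightarrow> Ds \<inter> X \<noteq> {})"

lemma consistent_chain_union:
  fixes X :: "nat \<Rightarrow> ('p, 'f) sequent set"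
  assumes "mono X" and "\<And>n. consistent L (X n)"
  shows "consistent L (\<Union>n. X n)"
  unfolding consistent_def
proof (intro conjI allI impI)
  show "\<forall>S\<in>\<Union>n. X n. is_sequent L S" using assms(2) by (auto simp: consistent_def)
  fix H assume "set_mset H \<subseteq> (\<Union>n. X n)"
  then have "\<exists>n. set_mset H \<subseteq> X n"
  proof (induction H)
    case (add S H)
    then obtain m n where "S \<in> X m" "set_mset H \<subseteq> X n" by auto
    then have "set_mset (add_mset S H) \<subseteq> X (max m n)"
      using monoD[OF assms(1), of m "max m n"] monoD[OF assms(1), of n "max m n"] by auto
    then show ?case by blast
  qed simp
  then show "\<not> GL_derivable L H" using assms(2) by (auto simp: consistent_def)
qed

text \<open>
  The demands are countable, so they are met one after the other, each one infinitely often because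
  its sequent may enter the set only at a late stage. Each stage adds at most one sequent, which leaves
  infinitely many variables unused.
\<close>

theorem saturated_extension:
  fixes X0 :: "('p, 'f) sequent set"
  assumes "countable_language L" and "consistent L X0" and "infinite (unused X0)"
  obtains X where "X0 \<subseteq> X" and "consistent L X" and "saturated L X"
proof -
  define C where "C = {(S, Ds). is_sequent L S \<and> demand L S Ds}"
  have C: "countable C" unfolding C_def by (rule countable_demands[OF assms(1)])
  \<comment> \<open>Stage \<open>prod_encode (i, j)\<close> is not earlier than \<open>j\<close> and handles the demand with number \<open>i\<close>.\<close>
  define d where "d n = from_nat_into C (fst (prod_decode n))" for n
  have "\<exists>X. \<forall>n. (consistent L (X n) \<and> infinite (unused (X n)) \<and> X0 \<subseteq> X n) \<and>
      (X n \<subseteq> X (Suc n) \<and>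
       (fst (d n) \<in> X n \<longrightarrow> demand L (fst (d n)) (snd (d n)) \<longrightarrow> snd (d n) \<inter> X (Suc n) \<noteq> {}))"
  proof (rule dependent_nat_choice)
    show "\<exists>X. consistent L X \<and> infinite (unused X) \<and> X0 \<subseteq> X" using assms by blast
    fix X n
    assume X: "consistent L X \<and> infinite (unused X) \<and> X0 \<subseteq> X"
    show "\<exists>Y. (consistent L Y \<and> infinite (unused Y) \<and> X0 \<subseteq> Y) \<and> X \<subseteq> Y \<and>
        (fst (d n) \<in> X \<longrightarrow> demand L (fst (d n)) (snd (d n)) \<longrightarrow> snd (d n) \<inter> Y \<noteq> {})"
    proof (cases "fst (d n) \<in> X \<and> demand L (fst (d n)) (snd (d n))")
      case True
      then obtain D where "D \<in> snd (d n)" "consistent L (insert D X)"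
        using consistent_extend X by blast
      then show ?thesis
        using X infinite_unused_insert[of X D] by (intro exI[of _ "insert D X"]) auto
    next
      case False
      then show ?thesis using X by blast
    qed
  qed
  then obtain X where X: "\<And>n. consistent L (X n)" "\<And>n. X0 \<subseteq> X n" "\<And>n. X n \<subseteq> X (Suc n)"
    and step: "\<And>n. fst (d n) \<in> X n \<Longrightarrow> demand L (fst (d n)) (snd (d n)) \<Longrightarrow> snd (d n) \<inter> X (Suc n) \<noteq> {}"
    by blast
  have mono: "mono X" using X(3) by (simp add: mono_iff_le_Suc)
  have con: "consistent L (\<Union>n. X n)" by (rule consistent_chain_union[OF mono X(1)])
  moreover have "saturated L (\<Union>n. X n)"
    unfolding saturated_def
  proof (intro ballI allI impI)
    fix S Ds assume "S \<in> (\<Union>n. X n)" and dem: "demand L S Ds"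
    then obtain j where j: "S \<in> X j" by blast
    have "(S, Ds) \<in> C" using dem j X(1) by (auto simp: C_def consistent_def)
    then obtain i where i: "from_nat_into C i = (S, Ds)"
      using from_nat_into_surj[OF C] by blast
    have "d (prod_encode (i, j)) = (S, Ds)" by (simp add: d_def i)
    moreover have "S \<in> X (prod_encode (i, j))"
      using j monoD[OF mono le_prod_encode_2] by blast
    ultimately show "Ds \<inter> (\<Union>n. X n) \<noteq> {}"
      using step[of "prod_encode (i, j)"] dem by auto
  qed
  moreover have "X0 \<subseteq> (\<Union>n. X n)" using X(2) by blast
  ultimately show ?thesis using that by blast
qed

section \<open>Values under substitution and renaming\<close>

lemma tm_val_upd_fresh: "w \<notin> tm_vars t \<Longrightarrow> tm_val M (\<beta>(w := m)) t = tm_val M \<beta> t"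
  by (induction t) (auto cong: map_cong)

lemma tm_val_subst: "tm_val M \<beta> (tm_subst w s t) = tm_val M (\<beta>(w := tm_val M \<beta> s)) t"
  by (induction t) (auto cong: map_cong simp: comp_def)

lemma fm_val_subst:
  assumes "\<And>y. Bnd y \<notin> tm_vars t"
  shows "fm_val M \<beta> (subst (Bnd x) t A) = fm_val M (\<beta>(Bnd x := tm_val M \<beta> t)) A"
proof (induction A arbitrary: \<beta>)
  case (Pred p ts)
  show ?case
    by (simp only: subst.simps fm_val.simps list.map_comp comp_def tm_val_subst)
next
  case (All y A)
  have "fm_val M (\<beta>(Bnd y := m)) (if Bnd x = Bnd y then A else subst (Bnd x) t A) =
      fm_val M (\<beta>(Bnd x := tm_val M \<beta> t, Bnd y := m)) A" for m
  proof (cases "x = y")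
    case False
    then have "\<beta>(Bnd x := tm_val M \<beta> t, Bnd y := m) =
        (\<beta>(Bnd y := m))(Bnd x := tm_val M (\<beta>(Bnd y := m)) t)"
      by (simp only: tm_val_upd_fresh[OF assms]) (rule fun_upd_twist, simp)
    then show ?thesis using False All.IH[of "\<beta>(Bnd y := m)"] by (simp only: var.inject if_False)
  qed simp
  then show ?case by (simp only: subst.simps fm_val.simps)
next
  case (Ex y A)
  have "fm_val M (\<beta>(Bnd y := m)) (if Bnd x = Bnd y then A else subst (Bnd x) t A) =
      fm_val M (\<beta>(Bnd x := tm_val M \<beta> t, Bnd y := m)) A" for m
  proof (cases "x = y")
    case False
    then have "\<beta>(Bnd x := tm_val M \<beta> t, Bnd y := m) =
        (\<beta>(Bnd y := m))(Bnd x := tm_val M (\<beta>(Bnd y := m)) t)"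
      by (simp only: tm_val_upd_fresh[OF assms]) (rule fun_upd_twist, simp)
    then show ?thesis using False Ex.IH[of "\<beta>(Bnd y := m)"] by (simp only: var.inject if_False)
  qed simp
  then show ?case by (simp only: subst.simps fm_val.simps)
qed simp_all

definition reindex :: "(nat \<Rightarrow> nat) \<Rightarrow> (var \<Rightarrow> 'm) \<Rightarrow> var \<Rightarrow> 'm" where
  "reindex \<pi> \<beta> w = (case w of Free a \<Rightarrow> \<beta> (Free (\<pi> a)) | Bnd x \<Rightarrow> \<beta> (Bnd x))"

lemma reindex_upd: "reindex \<pi> (\<beta>(Bnd x := m)) = (reindex \<pi> \<beta>)(Bnd x := m)"
  by (auto simp: reindex_def fun_eq_iff split: var.split)

lemma tm_val_rename: "tm_val M \<beta> (tm_msubst (\<lambda>a. Var (Free (\<pi> a))) t) = tm_val M (reindex \<pi> \<beta>) t"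
  by (induction t) (auto cong: map_cong simp: comp_def reindex_def split: var.split)

lemma fm_val_rename: "fm_val M \<beta> (rename \<pi> A) = fm_val M (reindex \<pi> \<beta>) A"
  by (induction A arbitrary: \<beta>) (auto simp: tm_val_rename comp_def reindex_upd)

lemma weight_simps:
  "weight w (add_mset A \<Gamma>, \<Delta>) = weight w (\<Gamma>, \<Delta>) - w A"
  "weight w (\<Gamma>, add_mset A \<Delta>) = weight w (\<Gamma>, \<Delta>) + w A"
  by (auto simp: weight_def)

lemma sequent_val_eq_weight: "sequent_val M \<beta> S = weight (fm_val M \<beta>) S"
  by (simp add: sequent_val_def multiset_val_def weight_def)

lemma weight_rename_sequent:
  "weight (fm_val M \<beta>) (rename_sequent \<pi> S) = weight (fm_val M (reindex \<pi> \<beta>)) S"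
  by (cases S) (simp add: weight_def image_mset.compositionality comp_def fm_val_rename)

section \<open>The term model\<close>

primrec connectives :: "('p, 'f) fm \<Rightarrow> nat" where
  "connectives Bot = 0"
| "connectives (Pred p ts) = 0"
| "connectives (Imp A B) = Suc (connectives A + connectives B)"
| "connectives (All x A) = Suc (connectives A)"
| "connectives (Ex x A) = Suc (connectives A)"

lemma connectives_subst [simp]: "connectives (subst w t A) = connectives A"
  by (induction A) auto

text \<open>
  The elements are the terms of the language, moved into the type \<open>'m\<close> by the injection \<open>h\<close>.
\<close>

definition term_struct ::
  "('p, 'f) language \<Rightarrow> ('f tm \<Rightarrow> 'm) \<Rightarrow> (('p, 'f) fm \<Rightarrow> real) \<Rightarrow> ('p, 'f, 'm) struct" where
  "term_struct L h v =
     \<lparr>univ = h ` {t. lterm L t},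
      fun_interp = (\<lambda>f ms. h (Fn f (map (inv_into {t. lterm L t} h) ms))),
      pred_interp = (\<lambda>p ms. v (Pred p (map (inv_into {t. lterm L t} h) ms)))\<rparr>"

locale term_model =
  fixes L :: "('p, 'f) language" and h :: "'f tm \<Rightarrow> 'm" and v :: "('p, 'f) fm \<Rightarrow> real"
    and \<beta> :: "var \<Rightarrow> 'm"
  assumes inj_h: "inj_on h {t. lterm L t}" and v: "v \<in> valuations"
    and \<beta>: "\<And>a. \<beta> (Free a) = h (Var (Free a))"
begin

abbreviation "\<M> \<equiv> term_struct L h v"

lemma term_struct_simps:
  "univ \<M> = h ` {t. lterm L t}"
  "fun_interp \<M> f ms = h (Fn f (map (inv_into {t. lterm L t} h) ms))"
  "pred_interp \<M> p ms = v (Pred p (map (inv_into {t. lterm L t} h) ms))"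
  by (simp_all add: term_struct_def)

lemma map_inv_h: "\<forall>t\<in>set ts. lterm L t \<Longrightarrow> map (inv_into {t. lterm L t} h) (map h ts) = ts"
  using inj_h by (auto intro!: map_idI)

lemma tm_val_term_model: "lterm L t \<Longrightarrow> tm_val \<M> \<beta> t = h t"
proof (induction rule: lterm.induct)
  case (1 a)
  then show ?case by (simp add: \<beta>)
next
  case (2 f ts)
  then have "map (tm_val \<M> \<beta>) ts = map h ts" by auto
  moreover have "map (inv_into {t. lterm L t} h) (map h ts) = ts" using 2 by (intro map_inv_h) auto
  ultimately show ?case by (simp only: tm_val.simps term_struct_simps)
qed

lemma fm_val_bounds: "0 \<le> fm_val \<M> \<gamma> A \<and> fm_val \<M> \<gamma> A \<le> 1"
proof (induction A arbitrary: \<gamma>)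
  case (Pred p ts)
  then show ?case using v by (auto simp: term_struct_simps valuations_def)
next
  case (Imp A B)
  show ?case using Imp(1)[of \<gamma>] Imp(2)[of \<gamma>] by auto
next
  case (All x A)
  have ne: "h (Var (Free 0)) \<in> univ \<M>" by (simp add: term_struct_simps)
  have "bdd_above ((\<lambda>m. fm_val \<M> (\<gamma>(Bnd x := m)) A) ` univ \<M>)"
    using All by (auto simp: bdd_above_def)
  from cSUP_upper2[OF this ne, of 0] show ?case
    using All ne by (auto intro!: cSUP_least)
next
  case (Ex x A)
  have ne: "h (Var (Free 0)) \<in> univ \<M>" by (simp add: term_struct_simps)
  have "bdd_below ((\<lambda>m. fm_val \<M> (\<gamma>(Bnd x := m)) A) ` univ \<M>)"
    using Ex by (auto simp: bdd_below_def)
  from cINF_lower2[OF this ne, of 1] show ?case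
    using Ex ne by (auto intro!: cINF_greatest)
qed simp

lemma fm_val_instance:
  "lterm L t \<Longrightarrow> fm_val \<M> \<beta> (subst (Bnd x) t A) = fm_val \<M> (\<beta>(Bnd x := h t)) A"
  using lterm_no_Bnd[of L t] by (simp add: fm_val_subst tm_val_term_model)

lemma fm_val_All:
  "(\<forall>t. lterm L t \<longrightarrow> fm_val \<M> \<beta> (subst (Bnd x) t A) \<le> c) \<Longrightarrow> fm_val \<M> \<beta> (All x A) \<le> c"
  by (auto simp: fm_val_instance term_struct_simps intro!: cSUP_least) (use lterm_Free in blast)

lemma fm_val_All_ge:
  assumes "lterm L t"
  shows "fm_val \<M> \<beta> (subst (Bnd x) t A) \<le> fm_val \<M> \<beta> (All x A)"
proof -
  have "bdd_above ((\<lambda>m. fm_val \<M> (\<beta>(Bnd x := m)) A) ` univ \<M>)"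
    using fm_val_bounds by (intro bdd_aboveI[of _ 1]) auto
  from cSUP_upper[OF _ this, of "h t"] show ?thesis
    using assms by (simp add: fm_val_instance term_struct_simps)
qed

lemma fm_val_Ex:
  "(\<forall>t. lterm L t \<longrightarrow> c \<le> fm_val \<M> \<beta> (subst (Bnd x) t A)) \<Longrightarrow> c \<le> fm_val \<M> \<beta> (Ex x A)"
  by (auto simp: fm_val_instance term_struct_simps intro!: cINF_greatest) (use lterm_Free in blast)

lemma fm_val_Ex_le:
  assumes "lterm L t"
  shows "fm_val \<M> \<beta> (Ex x A) \<le> fm_val \<M> \<beta> (subst (Bnd x) t A)"
proof -
  have "bdd_below ((\<lambda>m. fm_val \<M> (\<beta>(Bnd x := m)) A) ` univ \<M>)"
    using fm_val_bounds by (intro bdd_belowI[of _ 0]) auto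
  from cINF_lower[OF this, of "h t"] show ?thesis
    using assms by (simp add: fm_val_instance term_struct_simps)
qed

lemma fm_val_atomic:
  assumes "formula L A" and "connectives A = 0"
  shows "fm_val \<M> \<beta> A = v A"
  using assms(1)
proof cases
  case 1
  then show ?thesis using v by (simp add: valuations_def)
next
  case (2 p ts)
  then have "map (tm_val \<M> \<beta>) ts = map h ts" by (auto simp: tm_val_term_model)
  moreover have "map (inv_into {t. lterm L t} h) (map h ts) = ts" using 2 by (intro map_inv_h) auto
  ultimately show ?thesis using 2(1) by (simp only: fm_val.simps term_struct_simps)
qed (use assms(2) in auto)

text \<open>
  The truth lemma. It is proved for whole sequents, by induction on the number of connectives and
  quantifiers, since the value of a single formula is not determined by the set. Where \<open>a\<close>, \<open>b\<close>
  are the values of the two parts of an implication and \<open>c\<close> is the weight of the rest of the sequent, the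
  cases follow from \<open>c - max (b - a) 0 = min c (c - b + a)\<close> for an implication on the left, from
  \<open>c + max (b - a) 0 = max c (c + b - a)\<close> for one on the right, and from the
  fact that the supremum (infimum) of a quantified formula ranges over its instances by terms: all
  instances are in the set on the side where a bound for all of them is required, and one instance
  is there on the other side.
\<close>

lemma saturated_weight_nonneg:
  assumes "saturated L X" and seq: "\<forall>S\<in>X. is_sequent L S" and "\<forall>S\<in>X. 0 \<le> weight v S"
  shows "S \<in> X \<Longrightarrow> 0 \<le> weight (fm_val \<M> \<beta>) S"
proof (induction "(\<Sum>A\<in>#fst S + snd S. connectives A)" arbitrary: S rule: less_induct)
  case less
  obtain \<Gamma> \<Delta> where S: "S = (\<Gamma>, \<Delta>)" by (cases S)
  have sat: "\<exists>D\<in>Ds. D \<in> X" if "demand L S Ds" for Ds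
    using assms(1) that less.prems unfolding saturated_def by blast
  have IH: "0 \<le> weight (fm_val \<M> \<beta>) D"
    if "D \<in> X" "(\<Sum>A\<in>#fst D + snd D. connectives A) < (\<Sum>A\<in>#fst S + snd S. connectives A)" for D
    using less.hyps that by blast
  show ?case
  proof (cases "\<exists>A \<in># \<Gamma> + \<Delta>. connectives A \<noteq> 0")
    case False
    have "fm_val \<M> \<beta> A = v A" if "A \<in># \<Gamma> + \<Delta>" for A
      using False that seq less.prems S by (intro fm_val_atomic) auto
    then have "image_mset (fm_val \<M> \<beta>) \<Gamma> = image_mset v \<Gamma>" "image_mset (fm_val \<M> \<beta>) \<Delta> = image_mset v \<Delta>"
      by (auto intro!: image_mset_cong)
    then have "weight (fm_val \<M> \<beta>) S = weight v S"
      by (simp add: S weight_def)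
    then show ?thesis using assms(3) less.prems by simp
  next
    case True
    then obtain A where A: "A \<in># \<Gamma> \<or> A \<in># \<Delta>" "connectives A \<noteq> 0" by auto
    from A(1) show ?thesis
    proof
      assume "A \<in># \<Gamma>"
      then obtain \<Gamma>' where \<Gamma>: "\<Gamma> = add_mset A \<Gamma>'" by (metis multi_member_split)
      show ?thesis
      proof (cases A)
        case (Imp B C)
        have "(\<Gamma>', \<Delta>) \<in> X" "(add_mset C \<Gamma>', add_mset B \<Delta>) \<in> X"
          using sat demand.Imp_left1[of L B C \<Gamma>' \<Delta>] demand.Imp_left2[of L B C \<Gamma>' \<Delta>]
          by (auto simp: S \<Gamma> Imp)
        from IH[OF this(1)] IH[OF this(2)] show ?thesis
          by (simp add: S \<Gamma> Imp weight_simps max_def)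
      next
        case (All x B)
        have "(add_mset (subst (Bnd x) t B) \<Gamma>', \<Delta>) \<in> X" if "lterm L t" for t
          using sat demand.All_left[OF that, of x B \<Gamma>' \<Delta>] by (auto simp: S \<Gamma> All)
        from IH[OF this] have "\<forall>t. lterm L t \<longrightarrow> fm_val \<M> \<beta> (subst (Bnd x) t B) \<le> weight (fm_val \<M> \<beta>) (\<Gamma>', \<Delta>)"
          by (simp add: S \<Gamma> All weight_simps)
        from fm_val_All[OF this] show ?thesis
          by (simp add: S \<Gamma> All weight_simps)
      next
        case (Ex x B)
        obtain a where "(add_mset (subst (Bnd x) (Var (Free a)) B) \<Gamma>', \<Delta>) \<in> X"
          using sat demand.Ex_left[of L x B \<Gamma>' \<Delta>] by (auto simp: S \<Gamma> Ex)
        from IH[OF this] fm_val_Ex_le[of "Var (Free a)" x B] show ?thesis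
          by (simp add: S \<Gamma> Ex weight_simps)
      qed (use A(2) in auto)
    next
      assume "A \<in># \<Delta>"
      then obtain \<Delta>' where \<Delta>: "\<Delta> = add_mset A \<Delta>'" by (metis multi_member_split)
      show ?thesis
      proof (cases A)
        case (Imp B C)
        have "(\<Gamma>, \<Delta>') \<in> X \<or> (add_mset B \<Gamma>, add_mset C \<Delta>') \<in> X"
          using sat demand.Imp_right[of L \<Gamma> B C \<Delta>'] by (auto simp: S \<Delta> Imp)
        then show ?thesis
          using IH[of "(\<Gamma>, \<Delta>')"] IH[of "(add_mset B \<Gamma>, add_mset C \<Delta>')"]
          by (auto simp: S \<Delta> Imp weight_simps max_def)
      next
        case (Ex x B)
        have "(\<Gamma>, add_mset (subst (Bnd x) t B) \<Delta>') \<in> X" if "lterm L t" for t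
          using sat demand.Ex_right[OF that, of \<Gamma> x B \<Delta>'] by (auto simp: S \<Delta> Ex)
        from IH[OF this] have "\<forall>t. lterm L t \<longrightarrow> - weight (fm_val \<M> \<beta>) (\<Gamma>, \<Delta>') \<le> fm_val \<M> \<beta> (subst (Bnd x) t B)"
          by (simp add: S \<Delta> Ex weight_simps) (smt (verit))
        from fm_val_Ex[OF this] show ?thesis
          by (simp add: S \<Delta> Ex weight_simps)
      next
        case (All x B)
        obtain a where "(\<Gamma>, add_mset (subst (Bnd x) (Var (Free a)) B) \<Delta>') \<in> X"
          using sat demand.All_right[of L \<Gamma> x B \<Delta>'] by (auto simp: S \<Delta> All)
        from IH[OF this] fm_val_All_ge[of "Var (Free a)" x B] show ?thesis
          by (simp add: S \<Delta> All weight_simps)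
      qed (use A(2) in auto)
    qed
  qed
qed

lemma term_model_is_interpretation:
  assumes "\<And>w. \<gamma> w \<in> univ \<M>"
  shows "is_interpretation L \<M> \<gamma>"
proof -
  have "lterm L (Fn f (map (inv_into {t. lterm L t} h) ms))"
    if "f \<in> funs L" "length ms = fun_arity L f" "set ms \<subseteq> univ \<M>" for f ms
  proof -
    have "lterm L (inv_into {t. lterm L t} h m)" if "m \<in> set ms" for m
      using inv_into_into[of m h "{t. lterm L t}"] that \<open>set ms \<subseteq> univ \<M>\<close>
      by (auto simp: term_struct_simps)
    then show ?thesis using that by (intro lterm.intros) auto
  qed
  moreover have "pred_interp \<M> p ms \<in> {0..1}" for p ms
    using v by (auto simp: term_struct_simps valuations_def)
  ultimately show ?thesis
    using assms by (auto simp: is_interpretation_def term_struct_simps) (use lterm_Free in blast)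
qed

end

section \<open>Approximate completeness\<close>

lemma weight_approx_sequent: "weight w (approx_sequent n S) = real n * weight w S - w Bot"
proof -
  have "(\<Sum>A\<in>#repeat_mset n M. w A) = real n * (\<Sum>A\<in>#M. w A)" for M
    by (induction n) (auto simp: algebra_simps)
  then show ?thesis by (simp add: weight_def approx_sequent_def algebra_simps)
qed

definition theory_sequents :: "nat \<Rightarrow> ('p, 'f) fm set \<Rightarrow> ('p, 'f) sequent set" where
  "theory_sequents n T = {approx_sequent n (replicate_mset m C, {#Bot#}) | m C. 0 < m \<and> C \<in> T}"

lemma is_sequent_approx:
  assumes "is_sequent L S"
  shows "is_sequent L (approx_sequent n S)"
proof -
  have "A \<in># M" if "A \<in># repeat_mset n M" for A :: "('a, 'b) fm" and M
    using that by (metis count_eq_zero_iff count_repeat_mset mult_0_right)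
  then show ?thesis
    using assms by (cases S) (auto simp: approx_sequent_def)
qed

lemma theory_sequents_are_sequents:
  "is_theory L T \<Longrightarrow> S \<in> theory_sequents n T \<Longrightarrow> is_sequent L S"
  by (auto simp: theory_sequents_def is_theory_def intro!: is_sequent_approx)

lemma theory_sequents_indexed:
  assumes "set_mset H \<subseteq> theory_sequents n T"
  obtains k :: nat and m C where "\<forall>i<k. 0 < m i \<and> C i \<in> T"
    and "H = {# approx_sequent n (replicate_mset (m i) (C i), {#Bot#}). i \<in># mset_set {..<k} #}"
proof -
  obtain xs where xs: "H = mset xs" by (metis ex_mset)
  have "\<exists>m C. 0 < m \<and> C \<in> T \<and> S = approx_sequent n (replicate_mset m C, {#Bot#})"
    if "S \<in> set xs" for S
  proof -
    have "S \<in> theory_sequents n T" using assms that xs by auto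
    then show ?thesis unfolding theory_sequents_def by blast
  qed
  then obtain m C where mC: "\<And>S. S \<in> set xs \<Longrightarrow>
      0 < m S \<and> C S \<in> T \<and> S = approx_sequent n (replicate_mset (m S) (C S), {#Bot#})"
    by metis
  have "map (\<lambda>i. approx_sequent n (replicate_mset (m (xs ! i)) (C (xs ! i)), {#Bot#})) [0..<length xs] = xs"
    using mC[OF nth_mem] by (intro nth_equalityI) simp_all
  then have "H = mset (map (\<lambda>i. approx_sequent n (replicate_mset (m (xs ! i)) (C (xs ! i)), {#Bot#})) [0..<length xs])"
    by (simp only: xs)
  also have "\<dots> = {# approx_sequent n (replicate_mset (m (xs ! i)) (C (xs ! i)), {#Bot#}).
      i \<in># mset_set {..<length xs} #}"
    by (simp only: mset_map mset_upt lessThan_atLeast0)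
  finally show ?thesis
    using mC[OF nth_mem] by (intro that[of "length xs" "\<lambda>i. m (xs ! i)" "\<lambda>i. C (xs ! i)"]) auto
qed

lemma rename_sequent_inverse:
  assumes "\<And>a. Free a \<in> hypersequent_vars {#S#} \<Longrightarrow> \<pi> (\<rho> a) = a"
  shows "rename_sequent \<pi> (rename_sequent \<rho> S) = S"
proof -
  have "rename \<pi> (rename \<rho> A) = A" if "A \<in># fst S + snd S" for A
  proof -
    have "rename \<pi> (rename \<rho> A) = fm_msubst idvar A"
      unfolding fm_msubst_msubst using assms that
      by (intro fm_msubst_cong) (auto simp: hypersequent_vars_def)
    then show ?thesis by simp
  qed
  then have "image_mset (\<lambda>A. rename \<pi> (rename \<rho> A)) (fst S) = fst S"
    "image_mset (\<lambda>A. rename \<pi> (rename \<rho> A)) (snd S) = snd S"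
    by (auto intro!: image_mset_cong[where g = id, simplified])
  then show ?thesis
    by (cases S) (simp add: image_mset.compositionality comp_def)
qed

text \<open>
  The sequents of \<open>Y\<close> may contain all free variables between them, which would leave no eigenvariables. So all
  variables are moved to even numbers. A derivation over the renamed sequents involves only finitely many
  of them and can be renamed back.
\<close>

lemma consistent_doubled:
  assumes "\<forall>S\<in>Y. is_sequent L S" and "\<forall>H. set_mset H \<subseteq> Y \<longrightarrow> \<not> GL_derivable L H"
  shows "consistent L (rename_sequent (\<lambda>a. 2 * a) ` Y)"
  unfolding consistent_def
proof (intro conjI allI impI notI)
  show "\<forall>S\<in>rename_sequent (\<lambda>a. 2 * a) ` Y. is_sequent L S"
    using assms(1) by (auto simp del: map_prod_simp intro: rename_sequent_is_sequent)
  fix H' assume sub: "set_mset H' \<subseteq> rename_sequent (\<lambda>a. 2 * a) ` Y" and der: "GL_derivable L H'"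
  obtain H where H: "set_mset H \<subseteq> Y" "H' = image_mset (rename_sequent (\<lambda>a. 2 * a)) H"
    by (rule multiset_of_image[OF sub])
  have "finite (Free -` hypersequent_vars H)"
    by (rule finite_vimageI) (auto simp: hypersequent_vars_def inj_on_def)
  then obtain N where N: "\<And>a. Free a \<in> hypersequent_vars H \<Longrightarrow> a < N"
    by (metis finite_nat_set_iff_bounded vimageI)
  \<comment> \<open>An injection that inverts doubling below \<open>N\<close>; the other numbers are moved out of the way.\<close>
  define \<pi> where "\<pi> m = (if even m \<and> m div 2 < N then m div 2 else N + m)" for m
  have "inj \<pi>"
    by (rule injI) (auto simp: \<pi>_def elim!: evenE split: if_splits)
  then have "GL_derivable L (image_mset (rename_sequent \<pi>) H')"
    using der by (rule GL_derivable_rename)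
  moreover have "rename_sequent \<pi> (rename_sequent (\<lambda>a. 2 * a) S) = S" if "S \<in># H" for S
    using N that by (intro rename_sequent_inverse) (auto simp: \<pi>_def hypersequent_vars_def)
  then have "image_mset (rename_sequent \<pi>) H' = H"
    unfolding H(2) image_mset.compositionality comp_def
    by (intro image_mset_cong[where g = id, simplified]) auto
  ultimately show False using assms(2) H(1) by auto
qed

lemma infinite_unused_doubled: "infinite (unused (rename_sequent (\<lambda>a. 2 * a) ` Y))"
proof -
  have "2 * k + 1 \<in> unused (rename_sequent (\<lambda>a. 2 * a) ` Y)" for k
    by (auto simp: unused_def hypersequent_vars_def dest!: Free_in_rename) presburger+
  then have "range (\<lambda>k. 2 * k + 1) \<subseteq> unused (rename_sequent (\<lambda>a. 2 * a) ` Y)"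
    by blast
  moreover have "infinite (range (\<lambda>k :: nat. 2 * k + 1))"
    by (rule range_inj_infinite) (simp add: inj_on_def)
  ultimately show ?thesis using finite_subset by blast
qed

text \<open>
  Model existence: the doubled set is extended to a saturated one, a valuation for it defines the
  term model, and the assignment composed with doubling undoes the renaming.
\<close>

lemma underivable_model:
  fixes Y :: "('p, 'f) sequent set"
  assumes "infinite (UNIV :: 'm set)" and "countable_language L"
    and "\<forall>S\<in>Y. is_sequent L S" and "\<forall>H. set_mset H \<subseteq> Y \<longrightarrow> \<not> GL_derivable L H"
  obtains M :: "('p, 'f, 'm) struct" and \<beta> where "is_interpretation L M \<beta>"
    and "\<And>S. S \<in> Y \<Longrightarrow> 0 \<le> sequent_val M \<beta> S" and "\<And>A. 0 \<le> fm_val M \<beta> A"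
proof -
  obtain X where X: "rename_sequent (\<lambda>a. 2 * a) ` Y \<subseteq> X" "consistent L X" "saturated L X"
    using saturated_extension[OF assms(2) consistent_doubled[OF assms(3,4)] infinite_unused_doubled]
    by metis
  obtain v where val: "v \<in> valuations" "\<forall>S\<in>X. 0 \<le> weight v S"
    using consistent_valuation[OF X(2)] by blast
  obtain e :: "nat \<Rightarrow> 'm" where e: "inj e"
    using infinite_countable_subset[OF assms(1)] by blast
  define h where "h = e \<circ> to_nat_on {t. lterm L t}"
  define \<beta> where "\<beta> w = (case w of Free a \<Rightarrow> h (Var (Free a)) | Bnd x \<Rightarrow> h (Var (Free 0)))" for w
  interpret term_model L h v \<beta>
  proof
    show "inj_on h {t. lterm L t}"
      unfolding h_def using e countable_lterms[OF assms(2)]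
      by (intro comp_inj_on inj_on_to_nat_on) (auto intro: inj_on_subset)
  qed (auto simp: val \<beta>_def)
  show ?thesis
  proof
    show "is_interpretation L \<M> (reindex (\<lambda>a. 2 * a) \<beta>)"
      by (rule term_model_is_interpretation)
         (auto simp: reindex_def \<beta>_def term_struct_simps split: var.split)
    show "0 \<le> sequent_val \<M> (reindex (\<lambda>a. 2 * a) \<beta>) S" if "S \<in> Y" for S
    proof -
      have "rename_sequent (\<lambda>a. 2 * a) S \<in> X" using X(1) that by blast
      with X(2,3) val(2) have "0 \<le> weight (fm_val \<M> \<beta>) (rename_sequent (\<lambda>a. 2 * a) S)"
        by (intro saturated_weight_nonneg) (auto simp: consistent_def)
      then show ?thesis by (simp only: weight_rename_sequent sequent_val_eq_weight)
    qed
    show "0 \<le> fm_val \<M> (reindex (\<lambda>a. 2 * a) \<beta>) A" for A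
      using fm_val_bounds by blast
  qed
qed

theorem theorem3p1:
  fixes L :: "('p, 'f) language"
    and T :: "('p, 'f) fm set"
    and G :: "('p, 'f) hypersequent"
    and n :: nat
  assumes "infinite (UNIV :: 'm set)"
    and "countable_language L"
    and "is_theory L T"
    and "is_hypersequent L G"
    and "entails TYPE('m) L T G"
    and "n > 0"
  shows "\<exists>(k :: nat) (m :: nat \<Rightarrow> nat) (C :: nat \<Rightarrow> ('p, 'f) fm).
           (\<forall>i < k. m i > 0 \<and> C i \<in> T) \<and>
           GL_derivable L
             ({# approx_sequent n (replicate_mset (m i) (C i), {#Bot#}). i \<in># mset_set {..<k} #}
              + approx_hypersequent n G)"
proof (rule ccontr)
  assume neg: "\<not> ?thesis"
  define Y where "Y = theory_sequents n T \<union> set_mset (approx_hypersequent n G)"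
  have G: "is_hypersequent L (approx_hypersequent n G)"
    using assms(4) by (auto simp: is_hypersequent_def approx_hypersequent_def intro: is_sequent_approx)
  have seq: "\<forall>S\<in>Y. is_sequent L S"
    using theory_sequents_are_sequents[OF assms(3)] G by (auto simp: Y_def is_hypersequent_def)
  have "\<not> GL_derivable L H" if "set_mset H \<subseteq> Y" for H
  proof
    assume der: "GL_derivable L H"
    define K where "K = filter_mset (\<lambda>S. S \<in> theory_sequents n T) H"
    have K: "set_mset K \<subseteq> theory_sequents n T" by (auto simp: K_def)
    have "is_hypersequent L K"
      using theory_sequents_are_sequents[OF assms(3)] K by (auto simp: is_hypersequent_def)
    then have "GL_derivable L (K + approx_hypersequent n G)"
      using that G by (intro GL_derivable_mono[OF der]) (auto simp: K_def Y_def)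
    moreover obtain k :: nat and m :: "nat \<Rightarrow> nat" and C :: "nat \<Rightarrow> ('p, 'f) fm" where "\<forall>i<k. 0 < m i \<and> C i \<in> T"
      "K = {# approx_sequent n (replicate_mset (m i) (C i), {#Bot#}). i \<in># mset_set {..<k} #}"
      by (rule theory_sequents_indexed[OF K])
    ultimately show False using neg by blast
  qed
  then obtain M :: "('p, 'f, 'm) struct" and \<beta> where M: "is_interpretation L M \<beta>"
    "\<And>S. S \<in> Y \<Longrightarrow> 0 \<le> sequent_val M \<beta> S" "\<And>A. 0 \<le> fm_val M \<beta> A"
    using underivable_model[OF assms(1,2) seq] by blast
  \<comment> \<open>The sequent for \<open>C\<close> and \<open>m\<close> has the value \<open>n * (1 - m * c) - 1\<close> where \<open>c\<close> is the value of \<open>C\<close>;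
    this cannot be nonnegative for all \<open>m > 0\<close> unless \<open>c = 0\<close>.\<close>
  have "fm_val M \<beta> C = 0" if "C \<in> T" for C
  proof (rule ccontr)
    assume "fm_val M \<beta> C \<noteq> 0"
    then have "0 < fm_val M \<beta> C" using M(3)[of C] by linarith
    then obtain m :: nat where m: "1 < m * fm_val M \<beta> C"
      using reals_Archimedean3 by blast
    then have "0 < m" by (cases m) auto
    then have "approx_sequent n (replicate_mset m C, {#Bot#}) \<in> Y"
      unfolding Y_def theory_sequents_def using that by blast
    from M(2)[OF this] have "0 \<le> n * (1 - m * fm_val M \<beta> C) - 1"
      by (simp add: sequent_val_eq_weight weight_approx_sequent) (simp add: weight_def)
    moreover have "n * (1 - m * fm_val M \<beta> C) \<le> 0"
      using m by (intro mult_nonneg_nonpos) auto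
    ultimately show False by linarith
  qed
  then have "is_model L M \<beta> T"
    using M(1)
    by (auto simp: is_model_def true_in_def hypersequent_val_def hypersequent_of_def
        sequent_val_def multiset_val_def)
  then have "hypersequent_val M \<beta> G \<le> 0"
    using assms(5) by (simp add: entails_def true_in_def)
  \<comment> \<open>The additional \<open>Bot\<close> on the left of an approximation bounds the value of each sequent of \<open>G\<close>
    away from 0.\<close>
  moreover have "ereal (1 / n) \<le> hypersequent_val M \<beta> G"
    unfolding hypersequent_val_def
  proof (rule INF_greatest)
    fix S assume "S \<in># G"
    then have "approx_sequent n S \<in> Y"
      by (simp add: Y_def approx_hypersequent_def)
    from M(2)[OF this] show "ereal (1 / n) \<le> ereal (sequent_val M \<beta> S)"
      using assms(6) by (simp add: weight_approx_sequent sequent_val_eq_weight field_simps)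
  qed
  ultimately have "ereal (1 / n) \<le> 0" by (rule order_trans[rotated])
  then show False using assms(6) by simp
qed

end
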